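(* Let $K$ be a field of characteristic zero, let $\mathfrak{G}$ be a weakly Noetherian Lie algebra over $K$ and let $d>1$ be an integer. Then $\mathfrak{G}$ contains only finitely many maximal ideals $\mathfrak{m}$ such that $\mathfrak{G}/\mathfrak{m}$ is a simple Lie algebra of dimension $d$ over its centroid $L=\operatorname{Cent}(\mathfrak{G}/\mathfrak{m})$.
   Context: A Lie algebra $\mathfrak{G}$ over $K$ is weakly Noetherian if $\dim\mathfrak{m}/[\mathfrak{m},\mathfrak{m}]<\infty$ for every Lie subalgebra $\mathfrak{m}\subset\mathfrak{G}$. The centroid of a Lie algebra $\mathfrak{g}$ is $\operatorname{Cent}(\mathfrak{g})=\{\theta\in\operatorname{End}_K(\mathfrak{g})\mid\theta([x,y])=[x,\theta(y)]\ \forall x,y\in\mathfrak{g}\}$; when $\mathfrak{g}$ is simple it is a field containing $K$. One-dimensional Lie algebras are not considered simple. *)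

theory Defs
  imports "HOL-Algebra.Module" "HOL-Algebra.AbelCoset"
begin

definition char_zero :: "('a, 'm) ring_scheme \<Rightarrow> bool" where
  "char_zero R \<longleftrightarrow> (\<forall>n::nat. 0 < n \<longrightarrow> [n] \<cdot>\<^bsub>R\<^esub> \<one>\<^bsub>R\<^esub> \<noteq> \<zero>\<^bsub>R\<^esub>)"


section \<open>Span, basis and dimension for modules with carriers\<close>

definition lin_span ::
    "('a, 'm) ring_scheme \<Rightarrow> ('a, 'b, 'n) module_scheme \<Rightarrow> 'b set \<Rightarrow> 'b set" where
  "lin_span K V S =
     {v. \<exists>A c. finite A \<and> A \<subseteq> S \<and> c \<in> A \<rightarrow> carrier K \<and> v = (\<Oplus>\<^bsub>V\<^esub>x\<in>A. c x \<odot>\<^bsub>V\<^esub> x)}"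

definition lin_indep ::
    "('a, 'm) ring_scheme \<Rightarrow> ('a, 'b, 'n) module_scheme \<Rightarrow> 'b set \<Rightarrow> bool" where
  "lin_indep K V S \<longleftrightarrow>
     (\<forall>A c. finite A \<longrightarrow> A \<subseteq> S \<longrightarrow> c \<in> A \<rightarrow> carrier K \<longrightarrow>
        (\<Oplus>\<^bsub>V\<^esub>x\<in>A. c x \<odot>\<^bsub>V\<^esub> x) = \<zero>\<^bsub>V\<^esub> \<longrightarrow> (\<forall>x\<in>A. c x = \<zero>\<^bsub>K\<^esub>))"

definition is_basis ::
    "('a, 'm) ring_scheme \<Rightarrow> ('a, 'b, 'n) module_scheme \<Rightarrow> 'b set \<Rightarrow> bool" where
  "is_basis K V B \<longleftrightarrow> B \<subseteq> carrier V \<and> lin_indep K V B \<and> lin_span K V B = carrier V"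

definition has_dim ::
    "('a, 'm) ring_scheme \<Rightarrow> ('a, 'b, 'n) module_scheme \<Rightarrow> nat \<Rightarrow> bool" where
  "has_dim K V n \<longleftrightarrow> (\<exists>B. is_basis K V B \<and> finite B \<and> card B = n)"

definition fin_dim :: "('a, 'm) ring_scheme \<Rightarrow> ('a, 'b, 'n) module_scheme \<Rightarrow> bool" where
  "fin_dim K V \<longleftrightarrow> (\<exists>n. has_dim K V n)"


section \<open>Lie algebras\<close>

text \<open>The fields \<open>mult\<close> and \<open>one\<close> inherited from the record \<open>module\<close> are not used.\<close>

record ('a, 'b) lie_algebra = "('a, 'b) module" +
  bracket :: "['b, 'b] \<Rightarrow> 'b"  (\<open>\<lbrace>_, _\<rbrace>\<index>\<close>)

locale lie_algebra = module K G + K?: field K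
  for K (structure) and G :: "('a, 'b, 'n) lie_algebra_scheme" (structure) +
  assumes bracket_closed [simp, intro]:
      "\<lbrakk>x \<in> carrier G; y \<in> carrier G\<rbrakk> \<Longrightarrow> \<lbrace>x, y\<rbrace>\<^bsub>G\<^esub> \<in> carrier G"
    and bracket_add_left:
      "\<lbrakk>x \<in> carrier G; y \<in> carrier G; z \<in> carrier G\<rbrakk> \<Longrightarrow>
         \<lbrace>x \<oplus>\<^bsub>G\<^esub> y, z\<rbrace>\<^bsub>G\<^esub> = \<lbrace>x, z\<rbrace>\<^bsub>G\<^esub> \<oplus>\<^bsub>G\<^esub> \<lbrace>y, z\<rbrace>\<^bsub>G\<^esub>"
    and bracket_add_right:
      "\<lbrakk>x \<in> carrier G; y \<in> carrier G; z \<in> carrier G\<rbrakk> \<Longrightarrow>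
         \<lbrace>x, y \<oplus>\<^bsub>G\<^esub> z\<rbrace>\<^bsub>G\<^esub> = \<lbrace>x, y\<rbrace>\<^bsub>G\<^esub> \<oplus>\<^bsub>G\<^esub> \<lbrace>x, z\<rbrace>\<^bsub>G\<^esub>"
    and bracket_smult_left:
      "\<lbrakk>a \<in> carrier K; x \<in> carrier G; y \<in> carrier G\<rbrakk> \<Longrightarrow>
         \<lbrace>a \<odot>\<^bsub>G\<^esub> x, y\<rbrace>\<^bsub>G\<^esub> = a \<odot>\<^bsub>G\<^esub> \<lbrace>x, y\<rbrace>\<^bsub>G\<^esub>"
    and bracket_smult_right:
      "\<lbrakk>a \<in> carrier K; x \<in> carrier G; y \<in> carrier G\<rbrakk> \<Longrightarrow>
         \<lbrace>x, a \<odot>\<^bsub>G\<^esub> y\<rbrace>\<^bsub>G\<^esub> = a \<odot>\<^bsub>G\<^esub> \<lbrace>x, y\<rbrace>\<^bsub>G\<^esub>"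
    and bracket_self [simp]:
      "x \<in> carrier G \<Longrightarrow> \<lbrace>x, x\<rbrace>\<^bsub>G\<^esub> = \<zero>\<^bsub>G\<^esub>"
    and jacobi:
      "\<lbrakk>x \<in> carrier G; y \<in> carrier G; z \<in> carrier G\<rbrakk> \<Longrightarrow>
         \<lbrace>x, \<lbrace>y, z\<rbrace>\<^bsub>G\<^esub>\<rbrace>\<^bsub>G\<^esub> \<oplus>\<^bsub>G\<^esub> \<lbrace>y, \<lbrace>z, x\<rbrace>\<^bsub>G\<^esub>\<rbrace>\<^bsub>G\<^esub> \<oplus>\<^bsub>G\<^esub> \<lbrace>z, \<lbrace>x, y\<rbrace>\<^bsub>G\<^esub>\<rbrace>\<^bsub>G\<^esub> = \<zero>\<^bsub>G\<^esub>"

definition lie_subalgebra ::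
    "('a, 'm) ring_scheme \<Rightarrow> ('a, 'b, 'n) lie_algebra_scheme \<Rightarrow> 'b set \<Rightarrow> bool" where
  "lie_subalgebra K G H \<longleftrightarrow> submodule H K G \<and> (\<forall>x\<in>H. \<forall>y\<in>H. \<lbrace>x, y\<rbrace>\<^bsub>G\<^esub> \<in> H)"

definition lie_ideal ::
    "('a, 'm) ring_scheme \<Rightarrow> ('a, 'b, 'n) lie_algebra_scheme \<Rightarrow> 'b set \<Rightarrow> bool" where
  "lie_ideal K G I \<longleftrightarrow> submodule I K G \<and> (\<forall>x\<in>carrier G. \<forall>y\<in>I. \<lbrace>x, y\<rbrace>\<^bsub>G\<^esub> \<in> I)"

definition maximal_lie_ideal ::
    "('a, 'm) ring_scheme \<Rightarrow> ('a, 'b, 'n) lie_algebra_scheme \<Rightarrow> 'b set \<Rightarrow> bool" where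
  "maximal_lie_ideal K G I \<longleftrightarrow>
     lie_ideal K G I \<and> I \<noteq> carrier G \<and>
     (\<forall>J. lie_ideal K G J \<longrightarrow> I \<subseteq> J \<longrightarrow> J = I \<or> J = carrier G)"

definition simple_lie_algebra ::
    "('a, 'm) ring_scheme \<Rightarrow> ('a, 'b, 'n) lie_algebra_scheme \<Rightarrow> bool" where
  "simple_lie_algebra K G \<longleftrightarrow>
     lie_algebra K G \<and> carrier G \<noteq> {\<zero>\<^bsub>G\<^esub>} \<and> \<not> has_dim K G 1 \<and>
     (\<forall>I. lie_ideal K G I \<longrightarrow> I = {\<zero>\<^bsub>G\<^esub>} \<or> I = carrier G)"

definition derived_subalgebra ::
    "('a, 'm) ring_scheme \<Rightarrow> ('a, 'b, 'n) lie_algebra_scheme \<Rightarrow> 'b set" where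
  "derived_subalgebra K G = lin_span K G {\<lbrace>x, y\<rbrace>\<^bsub>G\<^esub> | x y. x \<in> carrier G \<and> y \<in> carrier G}"

text \<open>
  As for \<open>rcoset_mult\<close>, operations on cosets are unions over all representatives; for an
  ideal \<open>I\<close> all sets in such a union coincide.
\<close>

definition lie_quotient ::
    "('a, 'b, 'n) lie_algebra_scheme \<Rightarrow> 'b set \<Rightarrow> ('a, 'b set) lie_algebra"
    (infixl \<open>LieQuot\<close> 65) where
  "G LieQuot I =
     \<lparr>carrier = a_rcosets\<^bsub>G\<^esub> I, mult = undefined, one = undefined,
      zero = I, add = set_add G,
      smult = (\<lambda>a X. \<Union>x\<in>X. I +>\<^bsub>G\<^esub> (a \<odot>\<^bsub>G\<^esub> x)),
      bracket = (\<lambda>X Y. \<Union>x\<in>X. \<Union>y\<in>Y. I +>\<^bsub>G\<^esub> \<lbrace>x, y\<rbrace>\<^bsub>G\<^esub>)\<rparr>"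

definition weakly_noetherian ::
    "('a, 'm) ring_scheme \<Rightarrow> ('a, 'b, 'n) lie_algebra_scheme \<Rightarrow> bool" where
  "weakly_noetherian K G \<longleftrightarrow>
     (\<forall>H. lie_subalgebra K G H \<longrightarrow>
        fin_dim K (G\<lparr>carrier := H\<rparr> LieQuot derived_subalgebra K (G\<lparr>carrier := H\<rparr>)))"


section \<open>The centroid\<close>

text \<open>
  Endomorphisms are extensional functions on the carrier (\<open>\<rightarrow>\<^sub>E\<close>), so that equality of
  elements of the centroid is equality of maps.
\<close>

definition lin_endos ::
    "('a, 'm) ring_scheme \<Rightarrow> ('a, 'b, 'n) module_scheme \<Rightarrow> ('b \<Rightarrow> 'b) set" where
  "lin_endos K V =
     {f \<in> carrier V \<rightarrow>\<^sub>E carrier V.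
        (\<forall>x\<in>carrier V. \<forall>y\<in>carrier V. f (x \<oplus>\<^bsub>V\<^esub> y) = f x \<oplus>\<^bsub>V\<^esub> f y) \<and>
        (\<forall>a\<in>carrier K. \<forall>x\<in>carrier V. f (a \<odot>\<^bsub>V\<^esub> x) = a \<odot>\<^bsub>V\<^esub> f x)}"

definition centroid ::
    "('a, 'm) ring_scheme \<Rightarrow> ('a, 'b, 'n) lie_algebra_scheme \<Rightarrow> ('b \<Rightarrow> 'b) ring" where
  "centroid K G =
     \<lparr>carrier = {\<theta> \<in> lin_endos K G.
        \<forall>x\<in>carrier G. \<forall>y\<in>carrier G. \<theta> (\<lbrace>x, y\<rbrace>\<^bsub>G\<^esub>) = \<lbrace>x, \<theta> y\<rbrace>\<^bsub>G\<^esub>},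
      mult = compose (carrier G),
      one = (\<lambda>x\<in>carrier G. x),
      zero = (\<lambda>x\<in>carrier G. \<zero>\<^bsub>G\<^esub>),
      add = (\<lambda>\<theta> \<phi>. \<lambda>x\<in>carrier G. \<theta> x \<oplus>\<^bsub>G\<^esub> \<phi> x)\<rparr>"

text \<open>\<open>G\<close> as an algebra over its centroid, which acts by evaluation.\<close>

definition over_centroid ::
    "('a, 'b, 'n) lie_algebra_scheme \<Rightarrow> ('b \<Rightarrow> 'b, 'b) lie_algebra" where
  "over_centroid G =
     \<lparr>carrier = carrier G, mult = mult G, one = one G, zero = zero G, add = add G,
      smult = (\<lambda>\<theta> x. \<theta> x), bracket = bracket G\<rparr>"

end

theory Submission
  imports Defs
begin

text \<open>
  Suppose there are infinitely many such ideals. Operators on \<open>G\<close> built from iterated brackets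
  act on every quotient \<open>V = G/\<mm>\<close> linearly over its centroid \<open>L\<close>. If such an operator \<open>f\<close> has
  rank at most \<open>r\<close> on every \<open>V\<close>, then
  \<open>h(z) = [B(f v), f z] + [f v, B(f z)]\<close> vanishes on \<open>ker f\<close> and on \<open>v\<close>, so it has rank at most
  \<open>r - 1\<close> on every \<open>V\<close>; and whenever the image of \<open>f\<close> modulo \<open>\<mm>\<close> is not abelian, density
  provides \<open>B\<close> and \<open>v\<close> with \<open>h\<close> nonzero modulo \<open>\<mm>\<close>. Descending from the identity, which has
  rank \<open>d\<close>, one finds either an operator with abelian image modulo infinitely many \<open>\<mm>\<close> and
  nonzero there, or for infinitely many \<open>\<mm>\<close> an element outside \<open>\<mm>\<close> lying in all but finitely many of
  the others. By the Chinese remainder theorem each alternative yields a subalgebra that is abelian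
  modulo infinitely many of the ideals and separates them, so its abelianization is
  infinite-dimensional.
\<close>

section \<open>Finite codimension over a division ring of scalars\<close>

text \<open>The bound d is a dimension over the centroid, and the centroid changes with the ideal
  and may be infinite-dimensional over K, whereas weak Noetherianity counts dimensions over K. What
  the different quotients share is operators defined on G itself, so the descent is run on these and
  their rank is measured separately over each centroid. The expression h is alternating in the pair
  (z, v) by antisymmetry of the bracket alone: h(v) = 0 holds already in G, and a single choice of B
  and v lowers the rank bound modulo every ideal at once. Nonvanishing is another matter, since B
  and v are only adapted to one ideal. This asymmetry is the reason for the two alternatives: either
  h survives modulo infinitely many ideals and the descent goes on with h, or it survives modulo
  finitely many, and then a value of h outside the chosen ideal lies in all but finitely many of the
  others.\<close>

text \<open>
  The scalars are required to behave like a division ring only through their action on \<open>V\<close>;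
  this avoids establishing the ring axioms for the centroid.
\<close>

locale division_action = abelian_group V
  for R :: "('a, 'm) ring_scheme" and V :: "('a, 'b, 'n) module_scheme" (structure) +
  assumes act_closed [simp, intro]:
      "\<lbrakk>a \<in> carrier R; x \<in> carrier V\<rbrakk> \<Longrightarrow> a \<odot> x \<in> carrier V"
    and act_add:
      "\<lbrakk>a \<in> carrier R; x \<in> carrier V; y \<in> carrier V\<rbrakk> \<Longrightarrow> a \<odot> (x \<oplus> y) = a \<odot> x \<oplus> a \<odot> y"
    and ex_act_one: "\<exists>e\<in>carrier R. \<forall>x\<in>carrier V. e \<odot> x = x"
    and ex_act_minus: "\<exists>e\<in>carrier R. \<forall>x\<in>carrier V. e \<odot> x = \<ominus> x"
    and ex_act_sum: "\<lbrakk>a \<in> carrier R; b \<in> carrier R\<rbrakk> \<Longrightarrow>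
      \<exists>c\<in>carrier R. \<forall>x\<in>carrier V. c \<odot> x = a \<odot> x \<oplus> b \<odot> x"
    and ex_act_mult: "\<lbrakk>a \<in> carrier R; b \<in> carrier R\<rbrakk> \<Longrightarrow>
      \<exists>c\<in>carrier R. \<forall>x\<in>carrier V. c \<odot> x = a \<odot> (b \<odot> x)"
    and ex_act_inverse: "\<lbrakk>a \<in> carrier R; x \<in> carrier V; a \<odot> x \<noteq> \<zero>\<rbrakk> \<Longrightarrow>
      \<exists>b\<in>carrier R. b \<odot> (a \<odot> x) = x"
begin

definition subspace :: "'b set \<Rightarrow> bool" where
  "subspace N \<longleftrightarrow> N \<subseteq> carrier V \<and> \<zero> \<in> N \<and> (\<forall>x\<in>N. \<forall>y\<in>N. x \<oplus> y \<in> N) \<and>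
     (\<forall>a\<in>carrier R. \<forall>x\<in>N. a \<odot> x \<in> N)"

definition adjoin :: "'b set \<Rightarrow> 'b \<Rightarrow> 'b set" where
  "adjoin N w = {x \<oplus> a \<odot> w | x a. x \<in> N \<and> a \<in> carrier R}"

text \<open>An upper bound on the codimension, witnessed by n vectors whose successive adjunction
  exhausts \<open>V\<close>. The vectors may be redundant, and the base case asks for an inclusion,
  which makes the notion monotone in \<open>N\<close>.\<close>

primrec codim_le :: "nat \<Rightarrow> 'b set \<Rightarrow> bool" where
  "codim_le 0 N \<longleftrightarrow> carrier V \<subseteq> N"
| "codim_le (Suc n) N \<longleftrightarrow> (\<exists>w\<in>carrier V. codim_le n (adjoin N w))"

lemma ex_act_zero: "\<exists>z\<in>carrier R. \<forall>x\<in>carrier V. z \<odot> x = \<zero>"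
proof -
  obtain e f where "e \<in> carrier R" "\<forall>x\<in>carrier V. e \<odot> x = x"
    "f \<in> carrier R" "\<forall>x\<in>carrier V. f \<odot> x = \<ominus> x"
    using ex_act_one ex_act_minus by blast
  then show ?thesis using ex_act_sum[of e f] by (auto simp: r_neg)
qed

lemma act_zero: "a \<in> carrier R \<Longrightarrow> a \<odot> \<zero> = \<zero>"
  using act_add[of a \<zero> \<zero>] by (metis act_closed zero_closed l_zero add.r_cancel_one')

lemma subspace_zero_set: "subspace {\<zero>}"
  by (auto simp: subspace_def act_zero)

lemma subspace_minus: "subspace N \<Longrightarrow> x \<in> N \<Longrightarrow> \<ominus> x \<in> N"
  using ex_act_minus unfolding subspace_def by (metis subsetD)

lemma adjoinI: "x \<in> N \<Longrightarrow> a \<in> carrier R \<Longrightarrow> x \<oplus> a \<odot> w \<in> adjoin N w"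
  by (auto simp: adjoin_def)

lemma adjoin_mono: "N \<subseteq> N' \<Longrightarrow> adjoin N w \<subseteq> adjoin N' w"
  by (auto simp: adjoin_def)

lemma subset_adjoin:
  assumes "N \<subseteq> carrier V" "w \<in> carrier V"
  shows "N \<subseteq> adjoin N w"
proof
  fix x assume x: "x \<in> N"
  obtain z where "z \<in> carrier R" "z \<odot> w = \<zero>" using ex_act_zero assms by blast
  then show "x \<in> adjoin N w" using adjoinI[OF x, of z w] x assms by auto
qed

lemma mem_adjoin:
  assumes "subspace N" "w \<in> carrier V"
  shows "w \<in> adjoin N w"
proof -
  obtain e where "e \<in> carrier R" "e \<odot> w = w" using ex_act_one assms by blast
  then show ?thesis using adjoinI[of \<zero> N e w] assms by (auto simp: subspace_def)
qed

lemma adjoin_subset: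
  assumes "subspace N'" "N \<subseteq> N'" "w \<in> N'"
  shows "adjoin N w \<subseteq> N'"
proof
  fix y assume "y \<in> adjoin N w"
  then obtain x a where "x \<in> N" "a \<in> carrier R" "y = x \<oplus> a \<odot> w" by (auto simp: adjoin_def)
  then show "y \<in> N'" using assms by (simp add: subspace_def subset_iff)
qed

lemma subspace_adjoin:
  assumes N: "subspace N" and w: "w \<in> carrier V"
  shows "subspace (adjoin N w)"
  unfolding subspace_def
proof (intro conjI ballI)
  have NV: "N \<subseteq> carrier V" using N by (simp add: subspace_def)
  show "adjoin N w \<subseteq> carrier V" using NV w by (auto simp: adjoin_def)
  show "\<zero> \<in> adjoin N w" using subset_adjoin[OF NV w] N by (auto simp: subspace_def)
  fix x y assume "x \<in> adjoin N w" and "y \<in> adjoin N w"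
  then obtain u a v b where u: "u \<in> N" "a \<in> carrier R" "x = u \<oplus> a \<odot> w"
    and v: "v \<in> N" "b \<in> carrier R" "y = v \<oplus> b \<odot> w"
    by (auto simp: adjoin_def)
  obtain c where c: "c \<in> carrier R" "c \<odot> w = a \<odot> w \<oplus> b \<odot> w"
    using ex_act_sum[OF u(2) v(2)] w by blast
  have "x \<oplus> y = (u \<oplus> v) \<oplus> c \<odot> w"
    unfolding c(2) u(3) v(3) using u(1,2) v(1,2) w NV by (simp add: a_ac subset_iff)
  moreover have "u \<oplus> v \<in> N" using N u v by (simp add: subspace_def)
  ultimately show "x \<oplus> y \<in> adjoin N w" using adjoinI[OF _ c(1)] by metis
next
  fix b x assume b: "b \<in> carrier R" and "x \<in> adjoin N w"
  then obtain u a where u: "u \<in> N" "a \<in> carrier R" "x = u \<oplus> a \<odot> w"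
    by (auto simp: adjoin_def)
  obtain c where c: "c \<in> carrier R" "c \<odot> w = b \<odot> (a \<odot> w)"
    using ex_act_mult[OF b u(2)] w by blast
  have "u \<in> carrier V" using u N by (auto simp: subspace_def)
  then have "b \<odot> x = b \<odot> u \<oplus> c \<odot> w"
    unfolding c(2) u(3) using u w b by (simp add: act_add)
  moreover have "b \<odot> u \<in> N" using N u b by (simp add: subspace_def)
  ultimately show "b \<odot> x \<in> adjoin N w" using adjoinI[OF _ c(1)] by metis
qed

lemma codim_le_mono: "codim_le n N \<Longrightarrow> N \<subseteq> N' \<Longrightarrow> codim_le n N'"
proof (induction n arbitrary: N N')
  case (Suc n) then show ?case by (meson adjoin_mono codim_le.simps(2))
qed auto

lemma codim_le_Suc: "codim_le n N \<Longrightarrow> N \<subseteq> carrier V \<Longrightarrow> codim_le (Suc n) N"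
  by (meson codim_le.simps(2) codim_le_mono subset_adjoin zero_closed)

lemma adjoin_commute_subset:
  assumes N: "subspace N" and v: "v \<in> carrier V" and w: "w \<in> carrier V"
  shows "adjoin (adjoin N v) w \<subseteq> adjoin (adjoin N w) v"
proof (rule adjoin_subset)
  have sub: "subspace (adjoin N w)" "adjoin N w \<subseteq> carrier V"
    using subspace_adjoin[OF N w] by (auto simp: subspace_def)
  then show "subspace (adjoin (adjoin N w) v)" using subspace_adjoin v by blast
  have "N \<subseteq> carrier V" using N by (simp add: subspace_def)
  then show "adjoin N v \<subseteq> adjoin (adjoin N w) v"
    using adjoin_mono[OF subset_adjoin] w by blast
  show "w \<in> adjoin (adjoin N w) v"
    using subset_adjoin[OF sub(2) v] mem_adjoin[OF N w] by blast
qed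

text \<open>Steinitz exchange: in v = x + a w the part a w is nonzero because v is outside
  \<open>N\<close>, so some scalar takes a w = v - x back to w.\<close>

lemma adjoin_subset_exchange:
  assumes N: "subspace N" and v: "v \<in> adjoin N w" "v \<notin> N" and w: "w \<in> carrier V"
  shows "adjoin N w \<subseteq> adjoin N v"
proof -
  have NV: "N \<subseteq> carrier V" using N by (simp add: subspace_def)
  obtain x a where x: "x \<in> N" "a \<in> carrier R" "v = x \<oplus> a \<odot> w"
    using v(1) by (auto simp: adjoin_def)
  have xV: "x \<in> carrier V" using x NV by blast
  have "a \<odot> w \<noteq> \<zero>" using v(2) x xV by auto
  then obtain b where b: "b \<in> carrier R" "b \<odot> (a \<odot> w) = w" using ex_act_inverse x w by blast
  have vV: "v \<in> carrier V" using x xV w by simp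
  have sub: "subspace (adjoin N v)" using subspace_adjoin[OF N vV] .
  have "v \<in> adjoin N v" "\<ominus> x \<in> adjoin N v"
    using mem_adjoin[OF N vV] subset_adjoin[OF NV vV] subspace_minus[OF N x(1)] by auto
  then have "b \<odot> (\<ominus> x \<oplus> v) \<in> adjoin N v" using sub b by (simp add: subspace_def)
  moreover have "\<ominus> x \<oplus> v = a \<odot> w" unfolding x(3) using xV w x(2)
    by (simp add: r_neg1)
  ultimately have "w \<in> adjoin N v" using b by simp
  then show ?thesis using adjoin_subset[OF sub subset_adjoin[OF NV vV]] by blast
qed

text \<open>A vector outside \<open>N\<close> can replace one of the witnesses. If it lies in
  \<open>adjoin N w\<close> for the first witness w, it replaces w; otherwise it is outside the
  larger space, where induction applies, and the two adjunctions commute.\<close>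

lemma codim_le_exchange:
  assumes "codim_le (Suc n) N" "subspace N" "v \<in> carrier V" "v \<notin> N"
  shows "codim_le n (adjoin N v)"
  using assms
proof (induction n arbitrary: N)
  case (0 N)
  then obtain w where w: "w \<in> carrier V" "carrier V \<subseteq> adjoin N w" by auto
  then have "v \<in> adjoin N w" using 0 by blast
  then show ?case
    using codim_le_mono[of 0 "adjoin N w", OF _ adjoin_subset_exchange] 0 w by auto
next
  case (Suc n N)
  then obtain w where w: "w \<in> carrier V" "codim_le (Suc n) (adjoin N w)" by auto
  show ?case
  proof (cases "v \<in> adjoin N w")
    case True
    then show ?thesis
    using codim_le_mono[OF w(2) adjoin_subset_exchange[OF Suc.prems(2) _ Suc.prems(4) w(1)]] by blast
  next
    case False
    then have "codim_le n (adjoin (adjoin N w) v)"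
      using Suc.IH[OF w(2)] subspace_adjoin Suc.prems w by blast
    then have "codim_le n (adjoin (adjoin N v) w)"
      using codim_le_mono adjoin_commute_subset Suc.prems w by blast
    then show ?thesis using w(1) by auto
  qed
qed

text \<open>This is linear independence phrased by subspaces: the vector outside \<open>M i\<close>
  is adjoined to \<open>N\<close>, which uses up one unit of codimension and keeps \<open>N\<close>
  inside every other \<open>M j\<close>.\<close>

lemma codim_le_independent:
  assumes "codim_le n N" "subspace N" "finite F" "card F = Suc n"
    and "\<And>i. i \<in> F \<Longrightarrow> subspace (M i)" "\<And>i. i \<in> F \<Longrightarrow> N \<subseteq> M i"
    and "\<And>i. i \<in> F \<Longrightarrow> \<exists>x\<in>carrier V. x \<notin> M i \<and> (\<forall>j\<in>F - {i}. x \<in> M j)"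
  shows False
  using assms
proof (induction n arbitrary: N F)
  case (0 N F)
  then obtain i where "i \<in> F" by fastforce
  then show False using 0 by (metis codim_le.simps(1) subsetD)
next
  case (Suc n N F)
  then obtain i where i: "i \<in> F" by fastforce
  then obtain x where x: "x \<in> carrier V" "x \<notin> M i" "\<forall>j\<in>F - {i}. x \<in> M j"
    using Suc.prems by blast
  then have "x \<notin> N" using Suc.prems i by blast
  then have "codim_le n (adjoin N x)" using codim_le_exchange Suc.prems x by blast
  then show False
  proof (rule Suc.IH[where F = "F - {i}"])
    show "subspace (adjoin N x)" using subspace_adjoin Suc.prems x by blast
    show "finite (F - {i})" "card (F - {i}) = Suc n" using Suc.prems i by auto
    fix j assume j: "j \<in> F - {i}"
    then have jF: "j \<in> F" "x \<in> M j" using x by auto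
    show Mj: "subspace (M j)" using Suc.prems(5)[OF jF(1)] .
    show "adjoin N x \<subseteq> M j" using adjoin_subset[OF Mj Suc.prems(6)[OF jF(1)] jF(2)] .
    from Suc.prems(7)[OF jF(1)] obtain y where
      y: "y \<in> carrier V" "y \<notin> M j \<and> (\<forall>k\<in>F - {j}. y \<in> M k)" by (rule bexE)
    then show "\<exists>y\<in>carrier V. y \<notin> M j \<and> (\<forall>k\<in>F - {i} - {j}. y \<in> M k)"
      by (intro bexI[of _ y]) simp_all
  qed
qed

text \<open>The summand from an arbitrary \<open>N\<close> serves the induction on \<open>B\<close>:
  the term of the removed vector b is absorbed into it, giving an element of
  \<open>adjoin N b\<close>.\<close>

lemma codim_le_finsum:
  assumes "finite B" "B \<subseteq> carrier V" "subspace N"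
    and "\<And>v. v \<in> carrier V \<Longrightarrow> \<exists>x A c. x \<in> N \<and> A \<subseteq> B \<and> c \<in> A \<rightarrow> carrier R \<and>
           v = x \<oplus> (\<Oplus>b\<in>A. c b \<odot> b)"
  shows "codim_le (card B) N"
  using assms
proof (induction B arbitrary: N)
  case (empty N)
  have "v \<in> N" if "v \<in> carrier V" for v
    using empty.prems(3)[OF that] empty.prems(2) by (auto simp: subspace_def subset_iff)
  then show ?case by auto
next
  case (insert b B N)
  then have b: "b \<in> carrier V" and B: "B \<subseteq> carrier V" and N: "N \<subseteq> carrier V"
    by (auto simp: subspace_def)
  have "codim_le (card B) (adjoin N b)"
  proof (rule insert.IH[OF B subspace_adjoin[OF insert.prems(2) b]])
    fix v assume "v \<in> carrier V"
    then obtain x A c where x: "x \<in> N" "A \<subseteq> insert b B" "c \<in> A \<rightarrow> carrier R"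
      "v = x \<oplus> (\<Oplus>b\<in>A. c b \<odot> b)"
      using insert.prems(3) by meson
    show "\<exists>x A c. x \<in> adjoin N b \<and> A \<subseteq> B \<and> c \<in> A \<rightarrow> carrier R \<and>
        v = x \<oplus> (\<Oplus>b\<in>A. c b \<odot> b)"
    proof (cases "b \<in> A")
      case True
      define A' where "A' = A - {b}"
      have A': "A = insert b A'" "b \<notin> A'" "A' \<subseteq> B" "finite A'"
        using True x insert.hyps by (auto simp: A'_def intro: finite_subset)
      have c: "c b \<in> carrier R" "c \<in> A' \<rightarrow> carrier R" using x A' by auto
      have f: "(\<lambda>b. c b \<odot> b) \<in> A' \<rightarrow> carrier V"
        using c A' B by (auto simp: Pi_def subset_iff)
      have "v = (x \<oplus> c b \<odot> b) \<oplus> (\<Oplus>b\<in>A'. c b \<odot> b)"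
        unfolding x(4) A'(1) using f A' c b x(1) N
        by (subst finsum_insert) (auto simp: a_assoc subset_iff)
      then show ?thesis using adjoinI[OF x(1) c(1)] A'(3) c(2) by blast
    next
      case False
      then have "A \<subseteq> B" using x by blast
      then show ?thesis using x subset_adjoin[OF N b] by blast
    qed
  qed
  then show ?case using insert b by auto
qed

lemma codim_le_is_basis:
  assumes "is_basis R V B" "finite B"
  shows "codim_le (card B) {\<zero>}"
proof (rule codim_le_finsum[OF assms(2) _ subspace_zero_set])
  show B: "B \<subseteq> carrier V" using assms by (simp add: is_basis_def)
  fix v assume "v \<in> carrier V"
  then have "v \<in> lin_span R V B" using assms by (simp add: is_basis_def)
  then obtain A c where A: "A \<subseteq> B" "c \<in> A \<rightarrow> carrier R" "v = (\<Oplus>b\<in>A. c b \<odot> b)"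
    by (auto simp: lin_span_def)
  moreover from A B have "(\<Oplus>b\<in>A. c b \<odot> b) \<in> carrier V"
    by (intro finsum_closed) (auto simp: Pi_def subset_iff)
  ultimately have "A \<subseteq> B \<and> c \<in> A \<rightarrow> carrier R \<and> v = \<zero> \<oplus> (\<Oplus>b\<in>A. c b \<odot> b)" by simp
  then show "\<exists>x A c. x \<in> {\<zero>} \<and> A \<subseteq> B \<and> c \<in> A \<rightarrow> carrier R \<and>
        v = x \<oplus> (\<Oplus>b\<in>A. c b \<odot> b)"
    by blast
qed

end

lemma (in module) division_action_field:
  assumes "field R"
  shows "division_action R M"
proof
  show "\<exists>e\<in>carrier R. \<forall>x\<in>carrier M. e \<odot>\<^bsub>M\<^esub> x = x"
    by (intro bexI[of _ \<one>]) auto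
  show "\<exists>e\<in>carrier R. \<forall>x\<in>carrier M. e \<odot>\<^bsub>M\<^esub> x = \<ominus>\<^bsub>M\<^esub> x"
    using smult_l_minus[of \<one>] by (intro bexI[of _ "\<ominus> \<one>"]) auto
  fix a b assume ab: "a \<in> carrier R" "b \<in> carrier R"
  show "\<exists>c\<in>carrier R. \<forall>x\<in>carrier M. c \<odot>\<^bsub>M\<^esub> x = a \<odot>\<^bsub>M\<^esub> x \<oplus>\<^bsub>M\<^esub> b \<odot>\<^bsub>M\<^esub> x"
    using smult_l_distr ab by (intro bexI[of _ "a \<oplus> b"]) auto
  show "\<exists>c\<in>carrier R. \<forall>x\<in>carrier M. c \<odot>\<^bsub>M\<^esub> x = a \<odot>\<^bsub>M\<^esub> (b \<odot>\<^bsub>M\<^esub> x)"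
    using smult_assoc1 ab by (intro bexI[of _ "a \<otimes> b"]) auto
next
  fix a x assume ax: "a \<in> carrier R" "x \<in> carrier M" "a \<odot>\<^bsub>M\<^esub> x \<noteq> \<zero>\<^bsub>M\<^esub>"
  then have "a \<noteq> \<zero>" by auto
  then obtain b where "b \<in> carrier R" "b \<otimes> a = \<one>"
    using field.field_Units[OF assms] ax
    by (metis R.Units_l_inv_ex Diff_iff singletonD)
  then show "\<exists>b\<in>carrier R. b \<odot>\<^bsub>M\<^esub> (a \<odot>\<^bsub>M\<^esub> x) = x"
    using smult_assoc1[of b a x] ax by (intro bexI[of _ b]) auto
qed (auto simp: smult_r_distr)

section \<open>Linear spans and quotients\<close>

lemma (in module) submodule_finsum:
  assumes N: "submodule N R M" and "finite A" "f \<in> A \<rightarrow> N"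
  shows "(\<Oplus>\<^bsub>M\<^esub>x\<in>A. f x) \<in> N"
  using assms(2,3)
proof (induction A)
  case empty
  then show ?case using subgroup.one_closed[OF submodule.axioms(1)[OF N]] by simp
next
  case (insert a A)
  have NM: "N \<subseteq> carrier M" using submoduleE(1)[OF N] .
  then have "f \<in> A \<rightarrow> carrier M" "f a \<in> carrier M" using insert.prems by auto
  then have "(\<Oplus>\<^bsub>M\<^esub>x\<in>insert a A. f x) = f a \<oplus>\<^bsub>M\<^esub> (\<Oplus>\<^bsub>M\<^esub>x\<in>A. f x)"
    using insert.hyps by (simp add: M.finsum_insert)
  then show ?case using submoduleE(5)[OF N] insert by auto
qed

lemma (in module) lin_span_subset:
  assumes N: "submodule N R M" and S: "S \<subseteq> N"
  shows "lin_span R M S \<subseteq> N"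
proof
  fix v assume "v \<in> lin_span R M S"
  then obtain A c where A: "finite A" "A \<subseteq> S" "c \<in> A \<rightarrow> carrier R"
    "v = (\<Oplus>\<^bsub>M\<^esub>x\<in>A. c x \<odot>\<^bsub>M\<^esub> x)"
    by (auto simp: lin_span_def)
  have "(\<lambda>x. c x \<odot>\<^bsub>M\<^esub> x) \<in> A \<rightarrow> N"
    using A S submoduleE(4)[OF N] by blast
  then show "v \<in> N" using submodule_finsum[OF N A(1)] A(4) by simp
qed

text \<open>Padding with zero coefficients brings two linear combinations to a common index set, as
  needed for adding them.\<close>

lemma (in module) lin_span_extend:
  assumes "finite A" "B \<subseteq> A" "A \<subseteq> carrier M" "c \<in> B \<rightarrow> carrier R"
  obtains c' where "c' \<in> A \<rightarrow> carrier R"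
    "(\<Oplus>\<^bsub>M\<^esub>x\<in>A. c' x \<odot>\<^bsub>M\<^esub> x) = (\<Oplus>\<^bsub>M\<^esub>x\<in>B. c x \<odot>\<^bsub>M\<^esub> x)"
proof
  define c' where "c' = (\<lambda>x. if x \<in> B then c x else \<zero>)"
  show "c' \<in> A \<rightarrow> carrier R" using assms by (auto simp: c'_def)
  show "(\<Oplus>\<^bsub>M\<^esub>x\<in>A. c' x \<odot>\<^bsub>M\<^esub> x) = (\<Oplus>\<^bsub>M\<^esub>x\<in>B. c x \<odot>\<^bsub>M\<^esub> x)"
  proof (rule M.add.finprod_mono_neutral_cong_right[OF assms(1,2)])
    show "\<And>x. x \<in> A - B \<Longrightarrow> c' x \<odot>\<^bsub>M\<^esub> x = \<zero>\<^bsub>M\<^esub>"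
      using assms(3) by (auto simp: c'_def)
    show "(\<lambda>x. c' x \<odot>\<^bsub>M\<^esub> x) \<in> A \<rightarrow> carrier M"
      using assms by (auto simp: c'_def Pi_def subset_iff)
  qed (simp add: c'_def)
qed

lemma (in module) submodule_lin_span:
  assumes S: "S \<subseteq> carrier M"
  shows "submodule (lin_span R M S) R M"
proof (rule submoduleI)
  have fin: "(\<lambda>x. c x \<odot>\<^bsub>M\<^esub> x) \<in> A \<rightarrow> carrier M" if "A \<subseteq> S" "c \<in> A \<rightarrow> carrier R" for A c
    using that S by auto
  show sub: "lin_span R M S \<subseteq> carrier M"
    using lin_span_subset[OF carrier_is_submodule S] .
  show "\<zero>\<^bsub>M\<^esub> \<in> lin_span R M S"
    unfolding lin_span_def by (rule CollectI, rule exI[of _ "{}"]) auto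
  show smult: "a \<odot>\<^bsub>M\<^esub> x \<in> lin_span R M S"
    if a: "a \<in> carrier R" and x: "x \<in> lin_span R M S" for a x
  proof -
    obtain A c where A: "finite A" "A \<subseteq> S" "c \<in> A \<rightarrow> carrier R"
      "x = (\<Oplus>\<^bsub>M\<^esub>y\<in>A. c y \<odot>\<^bsub>M\<^esub> y)"
      using x by (auto simp: lin_span_def)
    have "a \<odot>\<^bsub>M\<^esub> x = (\<Oplus>\<^bsub>M\<^esub>y\<in>A. a \<odot>\<^bsub>M\<^esub> (c y \<odot>\<^bsub>M\<^esub> y))"
      unfolding A(4) using finsum_smult_ldistr[OF A(1) a fin[OF A(2,3)]] .
    also have "\<dots> = (\<Oplus>\<^bsub>M\<^esub>y\<in>A. (a \<otimes> c y) \<odot>\<^bsub>M\<^esub> y)"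
      using A S a by (intro M.finsum_cong') (auto simp: smult_assoc1 Pi_def subset_iff)
    finally show ?thesis unfolding lin_span_def using A a
      by (auto intro!: exI[of _ A] exI[of _ "\<lambda>y. a \<otimes> c y"])
  qed
  show "\<ominus>\<^bsub>M\<^esub> x \<in> lin_span R M S" if "x \<in> lin_span R M S" for x
    using smult[of "\<ominus> \<one>" x] that sub by (auto simp: smult_l_minus subset_iff)
  show "x \<oplus>\<^bsub>M\<^esub> y \<in> lin_span R M S"
    if x: "x \<in> lin_span R M S" and y: "y \<in> lin_span R M S" for x y
  proof -
    obtain A c where A: "finite A" "A \<subseteq> S" "c \<in> A \<rightarrow> carrier R"
      "x = (\<Oplus>\<^bsub>M\<^esub>y\<in>A. c y \<odot>\<^bsub>M\<^esub> y)"
      using x by (auto simp: lin_span_def)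
    obtain B d where B: "finite B" "B \<subseteq> S" "d \<in> B \<rightarrow> carrier R"
      "y = (\<Oplus>\<^bsub>M\<^esub>y\<in>B. d y \<odot>\<^bsub>M\<^esub> y)"
      using y by (auto simp: lin_span_def)
    have U: "finite (A \<union> B)" "A \<union> B \<subseteq> S" "A \<union> B \<subseteq> carrier M" using A B S by auto
    obtain c' where c': "c' \<in> A \<union> B \<rightarrow> carrier R" "(\<Oplus>\<^bsub>M\<^esub>x\<in>A \<union> B. c' x \<odot>\<^bsub>M\<^esub> x) = x"
      using lin_span_extend[OF U(1) _ U(3) A(3)] A(4) by auto
    obtain d' where d': "d' \<in> A \<union> B \<rightarrow> carrier R" "(\<Oplus>\<^bsub>M\<^esub>x\<in>A \<union> B. d' x \<odot>\<^bsub>M\<^esub> x) = y"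
      using lin_span_extend[OF U(1) _ U(3) B(3)] B(4) by auto
    have "x \<oplus>\<^bsub>M\<^esub> y = (\<Oplus>\<^bsub>M\<^esub>x\<in>A \<union> B. c' x \<odot>\<^bsub>M\<^esub> x \<oplus>\<^bsub>M\<^esub> d' x \<odot>\<^bsub>M\<^esub> x)"
      using M.finsum_addf[OF fin[OF U(2) c'(1)] fin[OF U(2) d'(1)]] c'(2) d'(2) by simp
    also have "\<dots> = (\<Oplus>\<^bsub>M\<^esub>x\<in>A \<union> B. (c' x \<oplus> d' x) \<odot>\<^bsub>M\<^esub> x)"
    proof (rule M.finsum_cong'[OF refl])
      have cd: "c' x \<in> carrier R" "d' x \<in> carrier R" "x \<in> carrier M" if "x \<in> A \<union> B" for x
        using that c'(1) d'(1) U(3) by blast+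
      then show "(\<lambda>x. (c' x \<oplus> d' x) \<odot>\<^bsub>M\<^esub> x) \<in> A \<union> B \<rightarrow> carrier M" by auto
      show "c' x \<odot>\<^bsub>M\<^esub> x \<oplus>\<^bsub>M\<^esub> d' x \<odot>\<^bsub>M\<^esub> x = (c' x \<oplus> d' x) \<odot>\<^bsub>M\<^esub> x" if "x \<in> A \<union> B" for x
        using cd[OF that] by (simp add: smult_l_distr)
    qed
    finally have "x \<oplus>\<^bsub>M\<^esub> y = (\<Oplus>\<^bsub>M\<^esub>x\<in>A \<union> B. (c' x \<oplus> d' x) \<odot>\<^bsub>M\<^esub> x)" .
    moreover have "(\<lambda>x. c' x \<oplus> d' x) \<in> A \<union> B \<rightarrow> carrier R" using c' d' by auto
    ultimately show ?thesis using U(1,2) unfolding lin_span_def by blast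
  qed
qed

section \<open>Cosets and quotients of a Lie algebra\<close>

context lie_algebra
begin

abbreviation coset :: "'b set \<Rightarrow> 'b \<Rightarrow> 'b set" where
  "coset I x \<equiv> I +>\<^bsub>G\<^esub> x"

lemma bracket_zero [simp]:
  assumes "x \<in> carrier G"
  shows "\<lbrace>x, \<zero>\<^bsub>G\<^esub>\<rbrace>\<^bsub>G\<^esub> = \<zero>\<^bsub>G\<^esub>" "\<lbrace>\<zero>\<^bsub>G\<^esub>, x\<rbrace>\<^bsub>G\<^esub> = \<zero>\<^bsub>G\<^esub>"
proof -
  have "\<lbrace>x, \<zero> \<odot>\<^bsub>G\<^esub> x\<rbrace>\<^bsub>G\<^esub> = \<zero> \<odot>\<^bsub>G\<^esub> \<lbrace>x, x\<rbrace>\<^bsub>G\<^esub>" "\<lbrace>\<zero> \<odot>\<^bsub>G\<^esub> x, x\<rbrace>\<^bsub>G\<^esub> = \<zero> \<odot>\<^bsub>G\<^esub> \<lbrace>x, x\<rbrace>\<^bsub>G\<^esub>"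
    by (rule bracket_smult_right[OF R.zero_closed assms assms],
        rule bracket_smult_left[OF R.zero_closed assms assms])
  then show "\<lbrace>x, \<zero>\<^bsub>G\<^esub>\<rbrace>\<^bsub>G\<^esub> = \<zero>\<^bsub>G\<^esub>" "\<lbrace>\<zero>\<^bsub>G\<^esub>, x\<rbrace>\<^bsub>G\<^esub> = \<zero>\<^bsub>G\<^esub>"
    using assms by simp_all
qed

lemma bracket_anti:
  assumes x: "x \<in> carrier G" and y: "y \<in> carrier G"
  shows "\<lbrace>x, y\<rbrace>\<^bsub>G\<^esub> = \<ominus>\<^bsub>G\<^esub> \<lbrace>y, x\<rbrace>\<^bsub>G\<^esub>"
proof -
  have "\<lbrace>x \<oplus>\<^bsub>G\<^esub> y, x \<oplus>\<^bsub>G\<^esub> y\<rbrace>\<^bsub>G\<^esub> = \<lbrace>x, y\<rbrace>\<^bsub>G\<^esub> \<oplus>\<^bsub>G\<^esub> \<lbrace>y, x\<rbrace>\<^bsub>G\<^esub>"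
    using x y by (simp add: bracket_add_left bracket_add_right M.a_comm del: bracket_self)
      (simp add: bracket_self M.a_comm)
  then have "\<lbrace>x, y\<rbrace>\<^bsub>G\<^esub> \<oplus>\<^bsub>G\<^esub> \<lbrace>y, x\<rbrace>\<^bsub>G\<^esub> = \<zero>\<^bsub>G\<^esub>" using x y by simp
  then show ?thesis using x y by (metis M.minus_equality bracket_closed)
qed

lemma bracket_minus:
  assumes "x \<in> carrier G" "y \<in> carrier G"
  shows "\<lbrace>\<ominus>\<^bsub>G\<^esub> x, y\<rbrace>\<^bsub>G\<^esub> = \<ominus>\<^bsub>G\<^esub> \<lbrace>x, y\<rbrace>\<^bsub>G\<^esub>" "\<lbrace>x, \<ominus>\<^bsub>G\<^esub> y\<rbrace>\<^bsub>G\<^esub> = \<ominus>\<^bsub>G\<^esub> \<lbrace>x, y\<rbrace>\<^bsub>G\<^esub>"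
proof -
  have "\<lbrace>(\<ominus> \<one>) \<odot>\<^bsub>G\<^esub> x, y\<rbrace>\<^bsub>G\<^esub> = (\<ominus> \<one>) \<odot>\<^bsub>G\<^esub> \<lbrace>x, y\<rbrace>\<^bsub>G\<^esub>"
    "\<lbrace>x, (\<ominus> \<one>) \<odot>\<^bsub>G\<^esub> y\<rbrace>\<^bsub>G\<^esub> = (\<ominus> \<one>) \<odot>\<^bsub>G\<^esub> \<lbrace>x, y\<rbrace>\<^bsub>G\<^esub>"
    by (rule bracket_smult_left[OF R.a_inv_closed[OF R.one_closed] assms],
        rule bracket_smult_right[OF R.a_inv_closed[OF R.one_closed] assms])
  then show "\<lbrace>\<ominus>\<^bsub>G\<^esub> x, y\<rbrace>\<^bsub>G\<^esub> = \<ominus>\<^bsub>G\<^esub> \<lbrace>x, y\<rbrace>\<^bsub>G\<^esub>" "\<lbrace>x, \<ominus>\<^bsub>G\<^esub> y\<rbrace>\<^bsub>G\<^esub> = \<ominus>\<^bsub>G\<^esub> \<lbrace>x, y\<rbrace>\<^bsub>G\<^esub>"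
    using assms by (simp_all add: smult_l_minus)
qed

lemma submodule_zero: "submodule I K G \<Longrightarrow> \<zero>\<^bsub>G\<^esub> \<in> I"
  using subgroup.one_closed[OF submodule.axioms(1)] by fastforce

lemma submodule_abelian_subgroup:
  assumes "submodule I K G"
  shows "abelian_subgroup I G"
  by (rule abelian_subgroupI3[OF additive_subgroup.intro[OF submodule.axioms(1)[OF assms]]
        M.abelian_group_axioms])

lemma carrier_quotient: "carrier (G LieQuot I) = coset I ` carrier G"
  by (auto simp: lie_quotient_def A_RCOSETS_def')

lemma zero_quotient [simp]: "\<zero>\<^bsub>G LieQuot I\<^esub> = I"
  by (simp add: lie_quotient_def)

lemma coset_in_quotient [simp, intro]: "x \<in> carrier G \<Longrightarrow> coset I x \<in> carrier (G LieQuot I)"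
  by (simp add: carrier_quotient)

lemma coset_self:
  assumes "submodule I K G" "x \<in> carrier G"
  shows "x \<in> coset I x"
proof -
  interpret I: abelian_subgroup I G using submodule_abelian_subgroup assms by blast
  show ?thesis using I.a_rcos_self assms by auto
qed

lemma coset_mem:
  assumes "submodule I K G" "x \<in> carrier G" "x' \<in> coset I x"
  shows "x' \<in> carrier G" "coset I x' = coset I x"
proof -
  interpret I: abelian_subgroup I G using submodule_abelian_subgroup assms by blast
  show "x' \<in> carrier G" using I.a_elemrcos_carrier assms by auto
  show "coset I x' = coset I x" using I.a_repr_independence' assms by auto
qed

lemma coset_eq_iff:
  assumes I: "submodule I K G" and x: "x \<in> carrier G" and y: "y \<in> carrier G"
  shows "coset I x = coset I y \<longleftrightarrow> x \<ominus>\<^bsub>G\<^esub> y \<in> I"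
proof -
  interpret I: abelian_subgroup I G using submodule_abelian_subgroup I by blast
  have "x \<ominus>\<^bsub>G\<^esub> y \<in> I \<longleftrightarrow> x \<in> coset I y"
    using I.a_rcos_module x y by (simp add: M.minus_eq)
  also have "\<dots> \<longleftrightarrow> coset I x = coset I y"
    using coset_mem[OF I y] coset_self[OF I x] by auto
  finally show ?thesis by blast
qed

lemma coset_eq_self_iff:
  assumes I: "submodule I K G" and x: "x \<in> carrier G"
  shows "coset I x = I \<longleftrightarrow> x \<in> I"
proof
  assume "coset I x = I" then show "x \<in> I" using coset_self[OF I x] by simp
next
  interpret I: abelian_subgroup I G using submodule_abelian_subgroup I by blast
  assume "x \<in> I" then show "coset I x = I" by (rule I.a_rcos_const)
qed

lemma coset_add:
  assumes "submodule I K G" "x \<in> carrier G" "y \<in> carrier G"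
  shows "coset I x \<oplus>\<^bsub>G LieQuot I\<^esub> coset I y = coset I (x \<oplus>\<^bsub>G\<^esub> y)"
proof -
  interpret I: abelian_subgroup I G using submodule_abelian_subgroup assms by blast
  show ?thesis using I.a_rcos_sum assms by (simp add: lie_quotient_def)
qed

lemma lie_idealD:
  assumes "lie_ideal K G I"
  shows "submodule I K G" "\<And>x y. x \<in> carrier G \<Longrightarrow> y \<in> I \<Longrightarrow> \<lbrace>x, y\<rbrace>\<^bsub>G\<^esub> \<in> I"
    "\<And>x y. x \<in> carrier G \<Longrightarrow> y \<in> I \<Longrightarrow> \<lbrace>y, x\<rbrace>\<^bsub>G\<^esub> \<in> I"
proof -
  show sub: "submodule I K G" "\<And>x y. x \<in> carrier G \<Longrightarrow> y \<in> I \<Longrightarrow> \<lbrace>x, y\<rbrace>\<^bsub>G\<^esub> \<in> I"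
    using assms by (auto simp: lie_ideal_def)
  fix x y assume "x \<in> carrier G" "y \<in> I"
  then show "\<lbrace>y, x\<rbrace>\<^bsub>G\<^esub> \<in> I"
    using bracket_anti[of y x] sub(2) submoduleE(1,3)[OF sub(1)] by (metis subsetD)
qed

lemma coset_smult:
  assumes I: "submodule I K G" and a: "a \<in> carrier K" and x: "x \<in> carrier G"
  shows "a \<odot>\<^bsub>G LieQuot I\<^esub> coset I x = coset I (a \<odot>\<^bsub>G\<^esub> x)"
proof -
  have "coset I (a \<odot>\<^bsub>G\<^esub> x') = coset I (a \<odot>\<^bsub>G\<^esub> x)" if "x' \<in> coset I x" for x'
  proof -
    have x': "x' \<in> carrier G" "x' \<ominus>\<^bsub>G\<^esub> x \<in> I"
      using coset_mem[OF I x that] coset_eq_iff[OF I _ x] by auto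
    have "a \<odot>\<^bsub>G\<^esub> (x' \<ominus>\<^bsub>G\<^esub> x) = a \<odot>\<^bsub>G\<^esub> x' \<ominus>\<^bsub>G\<^esub> a \<odot>\<^bsub>G\<^esub> x"
      using a x x' by (simp add: a_minus_def smult_r_distr smult_r_minus)
    then show ?thesis using submoduleE(4)[OF I a x'(2)] coset_eq_iff[OF I] a x x' by simp
  qed
  then have "(\<Union>x'\<in>coset I x. coset I (a \<odot>\<^bsub>G\<^esub> x')) = (\<Union>x'\<in>coset I x. coset I (a \<odot>\<^bsub>G\<^esub> x))"
    by (intro SUP_cong refl)
  also have "\<dots> = coset I (a \<odot>\<^bsub>G\<^esub> x)" using coset_self[OF I x] by blast
  finally show ?thesis by (simp add: lie_quotient_def)
qed

lemma coset_bracket: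
  assumes I: "lie_ideal K G I" and x: "x \<in> carrier G" and y: "y \<in> carrier G"
  shows "\<lbrace>coset I x, coset I y\<rbrace>\<^bsub>G LieQuot I\<^esub> = coset I \<lbrace>x, y\<rbrace>\<^bsub>G\<^esub>"
proof -
  note sub = lie_idealD(1)[OF I]
  have "coset I \<lbrace>x', y'\<rbrace>\<^bsub>G\<^esub> = coset I \<lbrace>x, y\<rbrace>\<^bsub>G\<^esub>"
    if "x' \<in> coset I x" "y' \<in> coset I y" for x' y'
  proof -
    have x': "x' \<in> carrier G" "x' \<ominus>\<^bsub>G\<^esub> x \<in> I" and y': "y' \<in> carrier G" "y' \<ominus>\<^bsub>G\<^esub> y \<in> I"
      using coset_mem[OF sub x that(1)] coset_mem[OF sub y that(2)] coset_eq_iff[OF sub] x y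
      by auto
    have "\<lbrace>x' \<ominus>\<^bsub>G\<^esub> x, y'\<rbrace>\<^bsub>G\<^esub> \<oplus>\<^bsub>G\<^esub> \<lbrace>x, y' \<ominus>\<^bsub>G\<^esub> y\<rbrace>\<^bsub>G\<^esub> \<in> I"
      using lie_idealD[OF I] x' y' x y submoduleE(5)[OF sub] by blast
    moreover have "\<lbrace>x' \<ominus>\<^bsub>G\<^esub> x, y'\<rbrace>\<^bsub>G\<^esub> \<oplus>\<^bsub>G\<^esub> \<lbrace>x, y' \<ominus>\<^bsub>G\<^esub> y\<rbrace>\<^bsub>G\<^esub> = \<lbrace>x', y'\<rbrace>\<^bsub>G\<^esub> \<ominus>\<^bsub>G\<^esub> \<lbrace>x, y\<rbrace>\<^bsub>G\<^esub>"
      using x y x' y' by (simp add: M.minus_eq bracket_add_left bracket_add_right bracket_minus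
          M.a_assoc M.r_neg1)
    ultimately show ?thesis using coset_eq_iff[OF sub] x y x' y' by simp
  qed
  then have "(\<Union>x'\<in>coset I x. \<Union>y'\<in>coset I y. coset I \<lbrace>x', y'\<rbrace>\<^bsub>G\<^esub>) =
      (\<Union>x'\<in>coset I x. \<Union>y'\<in>coset I y. coset I \<lbrace>x, y\<rbrace>\<^bsub>G\<^esub>)"
    by (intro SUP_cong refl)
  also have "\<dots> = coset I \<lbrace>x, y\<rbrace>\<^bsub>G\<^esub>"
    using coset_self[OF sub x] coset_self[OF sub y] by blast
  finally show ?thesis by (simp add: lie_quotient_def)
qed

lemma module_quotient:
  assumes I: "submodule I K G"
  shows "module K (G LieQuot I)"
proof (rule moduleI)
  show "cring K" by (rule R.cring_axioms)
  have zero: "coset I \<zero>\<^bsub>G\<^esub> = I"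
    using coset_eq_self_iff[OF I, of "\<zero>\<^bsub>G\<^esub>"] submodule_zero[OF I] by simp
  show "abelian_group (G LieQuot I)"
  proof (rule abelian_groupI)
    show "\<zero>\<^bsub>G LieQuot I\<^esub> \<in> carrier (G LieQuot I)"
      using zero coset_in_quotient[of "\<zero>\<^bsub>G\<^esub>" I] by simp
    fix X assume "X \<in> carrier (G LieQuot I)"
    then obtain x where x: "x \<in> carrier G" "X = coset I x" by (auto simp: carrier_quotient)
    have "coset I (\<ominus>\<^bsub>G\<^esub> x) \<oplus>\<^bsub>G LieQuot I\<^esub> X = I"
      using coset_add[OF I, of "\<ominus>\<^bsub>G\<^esub> x" x] x zero by (simp add: M.l_neg)
    then show "\<exists>Y\<in>carrier (G LieQuot I). Y \<oplus>\<^bsub>G LieQuot I\<^esub> X = \<zero>\<^bsub>G LieQuot I\<^esub>"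
      using x by auto
    have "coset I \<zero>\<^bsub>G\<^esub> \<oplus>\<^bsub>G LieQuot I\<^esub> X = X"
      using coset_add[OF I, of "\<zero>\<^bsub>G\<^esub>" x] x by simp
    then show "\<zero>\<^bsub>G LieQuot I\<^esub> \<oplus>\<^bsub>G LieQuot I\<^esub> X = X" using zero by simp
  qed (auto simp: carrier_quotient coset_add[OF I] M.a_ac)
qed (auto simp: carrier_quotient coset_smult[OF I] coset_add[OF I] smult_l_distr smult_r_distr smult_assoc1)

lemma division_action_quotient:
  assumes I: "submodule I K G"
  shows "division_action K (G LieQuot I)"
  by (rule module.division_action_field[OF module_quotient[OF I] K.field_axioms])

lemma lie_algebra_subalgebra:
  assumes "lie_subalgebra K G H"
  shows "lie_algebra K (G\<lparr>carrier := H\<rparr>)"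
proof -
  have H: "submodule H K G" "\<And>x y. x \<in> H \<Longrightarrow> y \<in> H \<Longrightarrow> \<lbrace>x, y\<rbrace>\<^bsub>G\<^esub> \<in> H"
    using assms by (auto simp: lie_subalgebra_def)
  have mod: "module K (G\<lparr>carrier := H\<rparr>)"
    by (rule submodule.submodule_is_module[OF H(1) module_axioms])
  have HG: "x \<in> carrier G" if "x \<in> H" for x using that submoduleE(1)[OF H(1)] by blast
  show ?thesis
  proof (intro lie_algebra.intro lie_algebra_axioms.intro mod K.field_axioms)
  qed (simp_all add: H(2) HG bracket_add_left bracket_add_right bracket_smult_left
        bracket_smult_right jacobi)
qed

end

section \<open>Maximal ideals with simple quotient\<close>

text \<open>The multiplication algebra of G: the unital associative algebra generated by the maps x
  |-> [y, x]. Composition is not a constructor but follows by induction on the outer factor, so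
  inductions have four cases. The members are total functions, meaningful on the carrier
  only.\<close>

inductive_set mult_ops ::
    "('a, 'm) ring_scheme \<Rightarrow> ('a, 'b, 'n) lie_algebra_scheme \<Rightarrow> ('b \<Rightarrow> 'b) set"
  for K :: "('a, 'm) ring_scheme" and G :: "('a, 'b, 'n) lie_algebra_scheme" where
  op_id: "(\<lambda>x. x) \<in> mult_ops K G"
| op_bracket: "\<lbrakk>f \<in> mult_ops K G; y \<in> carrier G\<rbrakk> \<Longrightarrow> (\<lambda>x. \<lbrace>y, f x\<rbrace>\<^bsub>G\<^esub>) \<in> mult_ops K G"
| op_add: "\<lbrakk>f \<in> mult_ops K G; g \<in> mult_ops K G\<rbrakk> \<Longrightarrow> (\<lambda>x. f x \<oplus>\<^bsub>G\<^esub> g x) \<in> mult_ops K G"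
| op_smult: "\<lbrakk>f \<in> mult_ops K G; a \<in> carrier K\<rbrakk> \<Longrightarrow> (\<lambda>x. a \<odot>\<^bsub>G\<^esub> f x) \<in> mult_ops K G"

lemma op_comp: "f \<in> mult_ops K G \<Longrightarrow> g \<in> mult_ops K G \<Longrightarrow> (\<lambda>x. f (g x)) \<in> mult_ops K G"
  by (induction rule: mult_ops.induct) (auto intro: mult_ops.intros)

context lie_algebra
begin

lemma op_closed [simp]: "f \<in> mult_ops K G \<Longrightarrow> x \<in> carrier G \<Longrightarrow> f x \<in> carrier G"
  by (induction rule: mult_ops.induct) auto

lemma op_plus:
  assumes "f \<in> mult_ops K G" "x \<in> carrier G" "y \<in> carrier G"
  shows "f (x \<oplus>\<^bsub>G\<^esub> y) = f x \<oplus>\<^bsub>G\<^esub> f y"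
  using assms
proof (induction rule: mult_ops.induct)
  case (op_add f g)
  then show ?case by (simp add: M.a_ac)
qed (simp_all add: bracket_add_right smult_r_distr)

lemma op_scale:
  assumes "f \<in> mult_ops K G" "x \<in> carrier G" "a \<in> carrier K"
  shows "f (a \<odot>\<^bsub>G\<^esub> x) = a \<odot>\<^bsub>G\<^esub> f x"
  using assms
proof (induction rule: mult_ops.induct)
  case (op_bracket f y)
  then show ?case using bracket_smult_right[of a y "f x"] by simp
next
  case (op_smult f b)
  then have "b \<odot>\<^bsub>G\<^esub> (a \<odot>\<^bsub>G\<^esub> f x) = a \<odot>\<^bsub>G\<^esub> (b \<odot>\<^bsub>G\<^esub> f x)"
    using smult_assoc1[of a b "f x"] smult_assoc1[of b a "f x"] by (simp add: R.m_comm)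
  then show ?case using op_smult by simp
qed (simp_all add: smult_r_distr)

lemma op_ideal:
  assumes I: "lie_ideal K G I" and "f \<in> mult_ops K G" "x \<in> I"
  shows "f x \<in> I"
  using assms(2,3)
proof (induction rule: mult_ops.induct)
qed (use lie_idealD(2)[OF I] submoduleE(4,5)[OF lie_idealD(1)[OF I]] in auto)

lemma op_minus:
  assumes f: "f \<in> mult_ops K G" and "x \<in> carrier G" "y \<in> carrier G"
  shows "f (x \<ominus>\<^bsub>G\<^esub> y) = f x \<ominus>\<^bsub>G\<^esub> f y"
proof -
  have "f (\<ominus>\<^bsub>G\<^esub> y) = \<ominus>\<^bsub>G\<^esub> f y"
    using op_scale[OF f, of y "\<ominus> \<one>"] assms by (simp add: smult_l_minus)
  then show ?thesis using op_plus[OF f, of x "\<ominus>\<^bsub>G\<^esub> y"] assms by (simp add: M.minus_eq)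
qed

lemma op_coset_cong:
  assumes I: "lie_ideal K G I" and f: "f \<in> mult_ops K G"
    and x: "x \<in> carrier G" "y \<in> carrier G" "coset I x = coset I y"
  shows "coset I (f x) = coset I (f y)"
  using coset_eq_iff[OF lie_idealD(1)[OF I]] op_ideal[OF I f, of "x \<ominus>\<^bsub>G\<^esub> y"] op_minus[OF f] x f
  by simp

lemma lie_idealI_coset:
  assumes I: "lie_ideal K G I" and JG: "J \<subseteq> carrier G" and IJ: "I \<subseteq> J"
    and add: "\<And>x y. \<lbrakk>x \<in> J; y \<in> J\<rbrakk> \<Longrightarrow> x \<oplus>\<^bsub>G\<^esub> y \<in> J"
    and smult: "\<And>a x. \<lbrakk>a \<in> carrier K; x \<in> J\<rbrakk> \<Longrightarrow> a \<odot>\<^bsub>G\<^esub> x \<in> J"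
    and bracket: "\<And>x y. \<lbrakk>x \<in> carrier G; y \<in> J\<rbrakk> \<Longrightarrow> \<lbrace>x, y\<rbrace>\<^bsub>G\<^esub> \<in> J"
  shows "lie_ideal K G J"
  unfolding lie_ideal_def
proof (intro conjI ballI bracket)
  show "submodule J K G"
  proof (rule submoduleI[OF JG])
    show "\<zero>\<^bsub>G\<^esub> \<in> J" using submodule_zero[OF lie_idealD(1)[OF I]] IJ by blast
    show "\<ominus>\<^bsub>G\<^esub> x \<in> J" if "x \<in> J" for x
      using smult[of "\<ominus> \<one>" x] that JG by (auto simp: smult_l_minus subset_iff)
  qed (use add smult in auto)
qed auto

text \<open>The set is A + I, described as the elements congruent modulo I to an element of
  A.\<close>

lemma submodule_sum:
  assumes I: "lie_ideal K G I" and A: "submodule A K G"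
  shows "submodule {x \<in> carrier G. \<exists>y\<in>A. coset I x = coset I y} K G"
    (is "submodule ?S K G")
proof -
  note sI = lie_idealD(1)[OF I]
  have AG: "y \<in> carrier G" if "y \<in> A" for y using that submoduleE(1)[OF A] by blast
  have smult: "a \<odot>\<^bsub>G\<^esub> x \<in> ?S" if a: "a \<in> carrier K" and x: "x \<in> ?S" for a x
  proof -
    obtain u where u: "x \<in> carrier G" "u \<in> A" "u \<in> carrier G" "coset I x = coset I u"
      using x AG by blast
    then show ?thesis
      using op_coset_cong[OF I op_smult[OF op_id a] u(1,3,4)] submoduleE(4)[OF A a u(2)] a by auto
  qed
  show ?thesis
  proof (rule submoduleI)
    show "?S \<subseteq> carrier G" by blast
    show "\<zero>\<^bsub>G\<^esub> \<in> ?S" using submodule_zero[OF A] by auto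
    show "\<ominus>\<^bsub>G\<^esub> x \<in> ?S" if "x \<in> ?S" for x
      using smult[of "\<ominus> \<one>" x] that by (simp add: smult_l_minus)
    fix x y assume x: "x \<in> ?S" and y: "y \<in> ?S"
    obtain u where u: "x \<in> carrier G" "u \<in> A" "u \<in> carrier G" "coset I x = coset I u"
      using x AG by blast
    obtain v where v: "y \<in> carrier G" "v \<in> A" "v \<in> carrier G" "coset I y = coset I v"
      using y AG by blast
    have "coset I (x \<oplus>\<^bsub>G\<^esub> y) = coset I (u \<oplus>\<^bsub>G\<^esub> v)"
      using coset_add[OF sI u(1) v(1)] coset_add[OF sI u(3) v(3)] u(4) v(4) by simp
    then show "x \<oplus>\<^bsub>G\<^esub> y \<in> ?S" using submoduleE(5)[OF A u(2) v(2)] u(1) v(1) by auto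
  qed (rule smult)
qed

end

locale simple_quotient = lie_algebra K G
  for K (structure) and G :: "('a, 'b, 'n) lie_algebra_scheme" (structure) +
  fixes \<mm> :: "'b set"
  assumes maximal: "maximal_lie_ideal K G \<mm>"
    and simple: "simple_lie_algebra K (G LieQuot \<mm>)"
begin

abbreviation Q :: "('a, 'b set) lie_algebra" where
  "Q \<equiv> G LieQuot \<mm>"

abbreviation L :: "('b set \<Rightarrow> 'b set) set" where
  "L \<equiv> carrier (centroid K Q)"

abbreviation \<pi> :: "'b \<Rightarrow> 'b set" where
  "\<pi> x \<equiv> coset \<mm> x"

lemma ideal: "lie_ideal K G \<mm>"
  using maximal by (simp add: maximal_lie_ideal_def)

lemma sub: "submodule \<mm> K G"
  by (rule lie_idealD(1)[OF ideal])

lemma lie_algebra_quotient: "lie_algebra K Q"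
  using simple by (simp add: simple_lie_algebra_def)

lemma \<pi>_eq_iff: "x \<in> carrier G \<Longrightarrow> \<pi> x = \<mm> \<longleftrightarrow> x \<in> \<mm>"
  by (rule coset_eq_self_iff[OF sub])

lemma ideal_cases: "lie_ideal K G J \<Longrightarrow> \<mm> \<subseteq> J \<Longrightarrow> J = \<mm> \<or> J = carrier G"
  using maximal by (simp add: maximal_lie_ideal_def)

lemma proper: "\<mm> \<noteq> carrier G" "\<mm> \<subseteq> carrier G"
  using maximal submoduleE(1)[OF sub] by (auto simp: maximal_lie_ideal_def)

text \<open>Irreducibility of the quotient under \<open>mult_ops\<close>: the elements congruent to
  some f u form an ideal that contains \<open>\<mm>\<close> and u, so maximality makes it all of
  G.\<close>

lemma op_transitive:
  assumes u: "u \<in> carrier G" "u \<notin> \<mm>" and x: "x \<in> carrier G"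
  shows "\<exists>f\<in>mult_ops K G. \<pi> x = \<pi> (f u)"
proof -
  let ?J = "{x \<in> carrier G. \<exists>f\<in>mult_ops K G. \<pi> x = \<pi> (f u)}"
  have "lie_ideal K G ?J" "\<mm> \<subseteq> ?J"
  proof -
    show mJ: "\<mm> \<subseteq> ?J"
    proof
      fix x assume x: "x \<in> \<mm>"
      have "(\<lambda>x. \<zero> \<odot>\<^bsub>G\<^esub> x) \<in> mult_ops K G" by (rule op_smult[OF op_id R.zero_closed])
      moreover have "\<pi> x = \<pi> (\<zero> \<odot>\<^bsub>G\<^esub> u)"
        using \<pi>_eq_iff[of x] \<pi>_eq_iff[of "\<zero>\<^bsub>G\<^esub>"] submodule_zero[OF sub] x proper u by auto
      ultimately show "x \<in> ?J" using x proper by blast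
    qed
    show "lie_ideal K G ?J"
    proof (rule lie_idealI_coset[OF ideal _ mJ])
      fix x y assume "x \<in> ?J"
      then obtain f where f: "x \<in> carrier G" "f \<in> mult_ops K G" "f u \<in> carrier G" "\<pi> x = \<pi> (f u)"
        using u by auto
      show "x \<oplus>\<^bsub>G\<^esub> y \<in> ?J" if y: "y \<in> ?J"
      proof -
        obtain g where g: "y \<in> carrier G" "g \<in> mult_ops K G" "g u \<in> carrier G" "\<pi> y = \<pi> (g u)"
          using y u by auto
        have "\<pi> (x \<oplus>\<^bsub>G\<^esub> y) = \<pi> (f u \<oplus>\<^bsub>G\<^esub> g u)"
          using coset_add[OF sub f(1) g(1)] coset_add[OF sub f(3) g(3)] f(4) g(4) by simp
        then show ?thesis using op_add[OF f(2) g(2)] f(1) g(1) by auto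
      qed
      show "a \<odot>\<^bsub>G\<^esub> x \<in> ?J" if a: "a \<in> carrier K" for a
        using op_coset_cong[OF ideal op_smult[OF op_id a] f(1,3,4)] op_smult[OF f(2) a] f(1) a
        by auto
      show "\<lbrace>y, x\<rbrace>\<^bsub>G\<^esub> \<in> ?J" if y: "y \<in> carrier G"
        using op_coset_cong[OF ideal op_bracket[OF op_id y] f(1,3,4)] op_bracket[OF f(2) y] f(1) y
        by auto
    qed auto
  qed
  moreover have "u \<in> ?J" using u op_id[of K G] by (auto intro: bexI[of _ "\<lambda>x. x"])
  ultimately have "?J = carrier G" using ideal_cases u(2) by blast
  then show ?thesis using x by blast
qed

text \<open>The preimage of the centre of the quotient is an ideal above \<open>\<mm>\<close>. If it
  contained u it would be everything, the quotient would be abelian, and transitivity would make it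
  a line, which the definition of simplicity excludes.\<close>

lemma bracket_notin:
  assumes u: "u \<in> carrier G" "u \<notin> \<mm>"
  shows "\<exists>y\<in>carrier G. \<lbrace>y, u\<rbrace>\<^bsub>G\<^esub> \<notin> \<mm>"
proof (rule ccontr)
  assume *: "\<not> ?thesis"
  let ?Z = "{x \<in> carrier G. \<forall>y\<in>carrier G. \<lbrace>y, x\<rbrace>\<^bsub>G\<^esub> \<in> \<mm>}"
  have "lie_ideal K G ?Z"
  proof (rule lie_idealI_coset[OF ideal])
    show "\<mm> \<subseteq> ?Z" using proper lie_idealD(2)[OF ideal] by blast
    show "\<lbrace>x, y\<rbrace>\<^bsub>G\<^esub> \<in> ?Z" if "x \<in> carrier G" "y \<in> ?Z" for x y
      using that lie_idealD(2)[OF ideal] by auto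
    show "x \<oplus>\<^bsub>G\<^esub> y \<in> ?Z" if "x \<in> ?Z" "y \<in> ?Z" for x y
      using that submoduleE(5)[OF sub] by (simp add: bracket_add_right)
    show "a \<odot>\<^bsub>G\<^esub> x \<in> ?Z" if a: "a \<in> carrier K" and x: "x \<in> ?Z" for a x
    proof -
      have "\<lbrace>y, a \<odot>\<^bsub>G\<^esub> x\<rbrace>\<^bsub>G\<^esub> \<in> \<mm>" if "y \<in> carrier G" for y
        using bracket_smult_right[of a y x] submoduleE(4)[OF sub a] x a that by simp
      then show ?thesis using a x by simp
    qed
  qed auto
  moreover have "\<mm> \<subseteq> ?Z" using proper lie_idealD(2)[OF ideal] by blast
  moreover have "u \<in> ?Z" using u * by blast
  ultimately have "?Z = carrier G" using ideal_cases u(2) by blast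
  then have abelian: "\<lbrace>x, y\<rbrace>\<^bsub>G\<^esub> \<in> \<mm>" if "x \<in> carrier G" "y \<in> carrier G" for x y
    using that by blast
  interpret Q: lie_algebra K Q by (rule lie_algebra_quotient)
  have X: "\<pi> u \<in> carrier Q" "\<pi> u \<noteq> \<zero>\<^bsub>Q\<^esub>" using u \<pi>_eq_iff by auto
  \<comment> \<open>Once all brackets vanish modulo \<open>\<mm>\<close>, every operator acts on the
    class of u as a scalar of \<open>K\<close>. Together with transitivity this shows that the class
    of u spans the quotient.\<close>
  have f: "\<exists>a\<in>carrier K. \<pi> (f u) = a \<odot>\<^bsub>Q\<^esub> \<pi> u" if "f \<in> mult_ops K G" for f
    using that
  proof (induction rule: mult_ops.induct)
    case op_id
    then show ?case using X by (intro bexI[of _ \<one>]) auto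
  next
    case (op_bracket f y)
    then have "\<pi> \<lbrace>y, f u\<rbrace>\<^bsub>G\<^esub> = \<zero>\<^bsub>Q\<^esub>" using abelian u \<pi>_eq_iff by simp
    then show ?case using X by (intro bexI[of _ \<zero>]) auto
  next
    case (op_add f g)
    then obtain a b where "a \<in> carrier K" "\<pi> (f u) = a \<odot>\<^bsub>Q\<^esub> \<pi> u"
      "b \<in> carrier K" "\<pi> (g u) = b \<odot>\<^bsub>Q\<^esub> \<pi> u" by blast
    then show ?case using op_add.hyps coset_add[OF sub, of "f u" "g u"] u X
      by (intro bexI[of _ "a \<oplus> b"]) (auto simp: Q.smult_l_distr)
  next
    case (op_smult f b)
    then obtain a where "a \<in> carrier K" "\<pi> (f u) = a \<odot>\<^bsub>Q\<^esub> \<pi> u" by blast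
    then show ?case using op_smult.hyps coset_smult[OF sub, of b "f u"] u X
      by (intro bexI[of _ "b \<otimes> a"]) (auto simp: Q.smult_assoc1)
  qed
  have "is_basis K Q {\<pi> u}"
    unfolding is_basis_def
  proof (intro conjI)
    show "{\<pi> u} \<subseteq> carrier Q" using X by blast
    show "lin_indep K Q {\<pi> u}"
      unfolding lin_indep_def
    proof (intro allI impI ballI)
      fix A c X assume A: "finite A" "A \<subseteq> {\<pi> u}" "c \<in> A \<rightarrow> carrier K"
        "(\<Oplus>\<^bsub>Q\<^esub>x\<in>A. c x \<odot>\<^bsub>Q\<^esub> x) = \<zero>\<^bsub>Q\<^esub>" and XA: "X \<in> A"
      then have AX: "A = {\<pi> u}" "X = \<pi> u" by auto
      have c: "c (\<pi> u) \<in> carrier K" using A AX by auto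
      have eq: "c (\<pi> u) \<odot>\<^bsub>Q\<^esub> \<pi> u = \<zero>\<^bsub>Q\<^esub>" using A(4) AX X c
        by (simp add: Q.M.finsum_insert del: zero_quotient)
      show "c X = \<zero>"
      proof (rule ccontr)
        assume "c X \<noteq> \<zero>"
        then have "c (\<pi> u) \<in> Units K" using K.field_Units c AX by simp
        then obtain b where b: "b \<in> carrier K" "b \<otimes> c (\<pi> u) = \<one>"
          using R.Units_l_inv_ex by blast
        have "\<pi> u = (b \<otimes> c (\<pi> u)) \<odot>\<^bsub>Q\<^esub> \<pi> u" using b X by simp
        also have "\<dots> = b \<odot>\<^bsub>Q\<^esub> (c (\<pi> u) \<odot>\<^bsub>Q\<^esub> \<pi> u)" by (rule Q.smult_assoc1[OF b(1) c X(1)])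
        also have "\<dots> = \<zero>\<^bsub>Q\<^esub>" using eq b Q.smult_r_null by (simp del: zero_quotient)
        finally show False using X by simp
      qed
    qed
    show "lin_span K Q {\<pi> u} = carrier Q"
    proof
      show "lin_span K Q {\<pi> u} \<subseteq> carrier Q"
        using Q.lin_span_subset[OF Q.carrier_is_submodule] X by blast
      show "carrier Q \<subseteq> lin_span K Q {\<pi> u}"
      proof
        fix Y assume "Y \<in> carrier Q"
        then obtain x where "x \<in> carrier G" "Y = \<pi> x" by (auto simp: carrier_quotient)
        then obtain a where a: "a \<in> carrier K" "Y = a \<odot>\<^bsub>Q\<^esub> \<pi> u"
          using op_transitive[OF u] f by metis
        then have "Y = (\<Oplus>\<^bsub>Q\<^esub>x\<in>{\<pi> u}. a \<odot>\<^bsub>Q\<^esub> x)" using X by (simp add: Q.M.finsum_insert del: zero_quotient)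
        moreover have "(\<lambda>_. a) \<in> {\<pi> u} \<rightarrow> carrier K" using a by simp
        ultimately have "finite {\<pi> u} \<and> {\<pi> u} \<subseteq> {\<pi> u} \<and> (\<lambda>_. a) \<in> {\<pi> u} \<rightarrow> carrier K \<and>
            Y = (\<Oplus>\<^bsub>Q\<^esub>x\<in>{\<pi> u}. a \<odot>\<^bsub>Q\<^esub> x)" by blast
        then show "Y \<in> lin_span K Q {\<pi> u}" unfolding lin_span_def
          by (intro CollectI exI[of _ "{\<pi> u}"] exI[of _ "\<lambda>_. a"])
      qed
    qed
  qed
  then have "has_dim K Q 1" unfolding has_dim_def by (intro exI[of _ "{\<pi> u}"]) auto
  then show False using simple by (simp add: simple_lie_algebra_def)
qed

end

section \<open>The centroid acts on a simple quotient like a division ring\<close>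

context simple_quotient
begin

lemma centroidD:
  assumes "\<theta> \<in> L"
  shows "X \<in> carrier Q \<Longrightarrow> \<theta> X \<in> carrier Q"
    and "\<lbrakk>X \<in> carrier Q; Y \<in> carrier Q\<rbrakk> \<Longrightarrow> \<theta> (X \<oplus>\<^bsub>Q\<^esub> Y) = \<theta> X \<oplus>\<^bsub>Q\<^esub> \<theta> Y"
    and "\<lbrakk>a \<in> carrier K; X \<in> carrier Q\<rbrakk> \<Longrightarrow> \<theta> (a \<odot>\<^bsub>Q\<^esub> X) = a \<odot>\<^bsub>Q\<^esub> \<theta> X"
    and "\<lbrakk>X \<in> carrier Q; Y \<in> carrier Q\<rbrakk> \<Longrightarrow> \<theta> \<lbrace>X, Y\<rbrace>\<^bsub>Q\<^esub> = \<lbrace>X, \<theta> Y\<rbrace>\<^bsub>Q\<^esub>"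
  using assms unfolding centroid_def lin_endos_def by auto

text \<open>The restriction to the carrier supplies the extensionality built into
  \<open>lin_endos\<close>.\<close>

lemma centroidI:
  assumes "\<And>X. X \<in> carrier Q \<Longrightarrow> \<theta> X \<in> carrier Q"
    and "\<And>X Y. \<lbrakk>X \<in> carrier Q; Y \<in> carrier Q\<rbrakk> \<Longrightarrow> \<theta> (X \<oplus>\<^bsub>Q\<^esub> Y) = \<theta> X \<oplus>\<^bsub>Q\<^esub> \<theta> Y"
    and "\<And>a X. \<lbrakk>a \<in> carrier K; X \<in> carrier Q\<rbrakk> \<Longrightarrow> \<theta> (a \<odot>\<^bsub>Q\<^esub> X) = a \<odot>\<^bsub>Q\<^esub> \<theta> X"
    and "\<And>X Y. \<lbrakk>X \<in> carrier Q; Y \<in> carrier Q\<rbrakk> \<Longrightarrow> \<theta> \<lbrace>X, Y\<rbrace>\<^bsub>Q\<^esub> = \<lbrace>X, \<theta> Y\<rbrace>\<^bsub>Q\<^esub>"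
  shows "restrict \<theta> (carrier Q) \<in> L"
proof -
  interpret Q: lie_algebra K Q by (rule lie_algebra_quotient)
  show ?thesis using assms unfolding centroid_def lin_endos_def by auto
qed

lemma centroid_zero:
  assumes "\<theta> \<in> L"
  shows "\<theta> \<mm> = \<mm>"
proof -
  interpret Q: lie_algebra K Q by (rule lie_algebra_quotient)
  have "\<theta> (\<zero> \<odot>\<^bsub>Q\<^esub> \<zero>\<^bsub>Q\<^esub>) = \<zero> \<odot>\<^bsub>Q\<^esub> \<theta> \<zero>\<^bsub>Q\<^esub>"
    using centroidD(3)[OF assms R.zero_closed Q.M.zero_closed] .
  then show ?thesis using centroidD(1)[OF assms Q.M.zero_closed]
    by (metis Q.smult_l_null Q.M.zero_closed zero_quotient)
qed

text \<open>Centroid elements commute with brackets, sums and scalars, hence with all of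
  \<open>mult_ops\<close>. Operators act on G and centroid elements on the quotient, so the
  commutation is expressed through a representative y of the image of x.\<close>

lemma op_centroid:
  assumes \<theta>: "\<theta> \<in> L" and f: "f \<in> mult_ops K G"
    and x: "x \<in> carrier G" and y: "y \<in> carrier G" and eq: "\<theta> (\<pi> x) = \<pi> y"
  shows "\<theta> (\<pi> (f x)) = \<pi> (f y)"
  using f
proof (induction rule: mult_ops.induct)
  case op_id
  then show ?case using eq .
next
  case (op_bracket f z)
  have fx: "f x \<in> carrier G" "f y \<in> carrier G" using op_bracket x y by auto
  have "\<theta> \<lbrace>\<pi> z, \<pi> (f x)\<rbrace>\<^bsub>Q\<^esub> = \<lbrace>\<pi> z, \<pi> (f y)\<rbrace>\<^bsub>Q\<^esub>"
    using centroidD(4)[OF \<theta>, of "\<pi> z" "\<pi> (f x)"] op_bracket fx by simp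
  then show ?case
    using coset_bracket[OF ideal op_bracket(2) fx(1)] coset_bracket[OF ideal op_bracket(2) fx(2)]
    by simp
next
  case (op_add f g)
  have c: "f x \<in> carrier G" "f y \<in> carrier G" "g x \<in> carrier G" "g y \<in> carrier G"
    using op_add x y by auto
  then show ?case
    using centroidD(2)[OF \<theta>, of "\<pi> (f x)" "\<pi> (g x)"] op_add
      coset_add[OF sub c(1,3)] coset_add[OF sub c(2,4)] by simp
next
  case (op_smult f a)
  have c: "f x \<in> carrier G" "f y \<in> carrier G" using op_smult x y by auto
  then show ?case
    using centroidD(3)[OF \<theta>, of a "\<pi> (f x)"] op_smult
      coset_smult[OF sub op_smult(2) c(1)] coset_smult[OF sub op_smult(2) c(2)] by simp
qed

text \<open>The two-vector case of the Jacobson density theorem.\<close>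

lemma density:
  assumes u: "u \<in> carrier G" and v: "v \<in> carrier G"
    and ann: "\<And>f. f \<in> mult_ops K G \<Longrightarrow> f v \<in> \<mm> \<Longrightarrow> f u \<in> \<mm>"
  shows "\<exists>\<theta>\<in>L. \<theta> (\<pi> v) = \<pi> u"
proof (cases "v \<in> \<mm>")
  case True
  then have "u \<in> \<mm>" using ann[OF op_id] by simp
  then have "\<pi> v = \<pi> u" using \<pi>_eq_iff[OF u] \<pi>_eq_iff[OF v] True by simp
  moreover have "(\<lambda>X\<in>carrier Q. X) \<in> L" by (rule centroidI) auto
  moreover have "(\<lambda>X\<in>carrier Q. X) (\<pi> v) = \<pi> v" using v by simp
  ultimately show ?thesis by metis
next
  case False
  \<comment> \<open>The desired centroid element sends the class of f v to the class of f u. The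
    choice of f does not matter: two candidates differ by an operator that maps v into
    \<open>\<mm>\<close>, and \<open>ann\<close> then says that it maps u there too.\<close>
  define g where "g X = \<pi> ((SOME f. f \<in> mult_ops K G \<and> X = \<pi> (f v)) u)" for X
  have g: "g (\<pi> (f v)) = \<pi> (f u)" if f: "f \<in> mult_ops K G" for f
  proof -
    define f' where "f' = (SOME f'. f' \<in> mult_ops K G \<and> \<pi> (f v) = \<pi> (f' v))"
    have f': "f' \<in> mult_ops K G" "\<pi> (f v) = \<pi> (f' v)"
      unfolding f'_def using someI[of "\<lambda>f'. f' \<in> mult_ops K G \<and> \<pi> (f v) = \<pi> (f' v)" f] f by auto
    have e: "f x \<oplus>\<^bsub>G\<^esub> (\<ominus> \<one>) \<odot>\<^bsub>G\<^esub> f' x = f x \<ominus>\<^bsub>G\<^esub> f' x" if "x \<in> carrier G" for x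
      using that f f' by (simp add: smult_l_minus M.minus_eq)
    have "(\<lambda>x. f x \<oplus>\<^bsub>G\<^esub> (\<ominus> \<one>) \<odot>\<^bsub>G\<^esub> f' x) \<in> mult_ops K G"
      by (intro op_add op_smult f f' R.a_inv_closed R.one_closed)
    from ann[OF this] have "f u \<ominus>\<^bsub>G\<^esub> f' u \<in> \<mm>"
      using e[OF u] e[OF v] coset_eq_iff[OF sub, of "f v" "f' v"] f' f v by simp
    then have "\<pi> (f u) = \<pi> (f' u)" using coset_eq_iff[OF sub, of "f u" "f' u"] f f'(1) u by simp
    then show ?thesis by (simp only: g_def f'_def)
  qed
  have surj: "\<exists>f\<in>mult_ops K G. X = \<pi> (f v)" if "X \<in> carrier Q" for X
    using that op_transitive[OF v False] by (auto simp: carrier_quotient)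
  have "restrict g (carrier Q) \<in> L"
  proof (rule centroidI)
    fix X assume "X \<in> carrier Q"
    then obtain f where f: "f \<in> mult_ops K G" "X = \<pi> (f v)" using surj by blast
    then have gX: "g X = \<pi> (f u)" using g by simp
    then show "g X \<in> carrier Q" using f u by simp
    show "g (a \<odot>\<^bsub>Q\<^esub> X) = a \<odot>\<^bsub>Q\<^esub> g X" if a: "a \<in> carrier K" for a
      using g[OF op_smult[OF f(1) a]] gX f u v a by (simp add: coset_smult[OF sub])
    fix Y assume "Y \<in> carrier Q"
    then obtain h where h: "h \<in> mult_ops K G" "Y = \<pi> (h v)" using surj by blast
    then have gY: "g Y = \<pi> (h u)" using g by simp
    show "g (X \<oplus>\<^bsub>Q\<^esub> Y) = g X \<oplus>\<^bsub>Q\<^esub> g Y"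
      using g[OF op_add[OF f(1) h(1)]] gX gY f h u v by (simp add: coset_add[OF sub])
    \<comment> \<open>Writing X as the class of f v turns the bracket with X into the operator z |->
      [f v, h z], to which the rule for g applies directly.\<close>
    have fv: "f v \<in> carrier G" using f v by simp
    show "g \<lbrace>X, Y\<rbrace>\<^bsub>Q\<^esub> = \<lbrace>X, g Y\<rbrace>\<^bsub>Q\<^esub>"
      using g[OF op_bracket[OF h(1) fv]] gY f(2) h u v fv by (simp add: coset_bracket[OF ideal])
  qed
  moreover have "g (\<pi> v) = \<pi> u" using g[OF op_id] by simp
  moreover have "restrict g (carrier Q) (\<pi> v) = g (\<pi> v)" using v by simp
  ultimately show ?thesis by metis
qed

text \<open>Schur's lemma: the kernel of a nonzero centroid element pulls back to a proper ideal
  containing \<open>\<mm>\<close>, which must be \<open>\<mm>\<close>.\<close>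

lemma centroid_kernel:
  assumes \<theta>: "\<theta> \<in> L" and x: "x \<in> carrier G" "\<theta> (\<pi> x) \<noteq> \<mm>"
    and y: "y \<in> carrier G" "\<theta> (\<pi> y) = \<mm>"
  shows "y \<in> \<mm>"
proof -
  let ?J = "{x \<in> carrier G. \<theta> (\<pi> x) = \<mm>}"
  have zero: "\<pi> \<zero>\<^bsub>G\<^esub> = \<mm>" using \<pi>_eq_iff[of "\<zero>\<^bsub>G\<^esub>"] submodule_zero[OF sub] by simp
  have mJ: "\<mm> \<subseteq> ?J"
  proof
    fix z assume z: "z \<in> \<mm>"
    then have "\<pi> z = \<mm>" "z \<in> carrier G" using \<pi>_eq_iff proper by auto
    then show "z \<in> ?J" using centroid_zero[OF \<theta>] by simp
  qed
  have *: "\<theta> (\<pi> z) = \<pi> \<zero>\<^bsub>G\<^esub>" if "z \<in> ?J" for z using that zero by simp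
  interpret Q: lie_algebra K Q by (rule lie_algebra_quotient)
  have "lie_ideal K G ?J"
  proof (rule lie_idealI_coset[OF ideal _ mJ])
    fix z assume z: "z \<in> ?J"
    show "z \<oplus>\<^bsub>G\<^esub> z' \<in> ?J" if "z' \<in> ?J" for z'
    proof -
      have "\<theta> (\<pi> (z \<oplus>\<^bsub>G\<^esub> z')) = \<theta> (\<pi> z) \<oplus>\<^bsub>Q\<^esub> \<theta> (\<pi> z')"
        using centroidD(2)[OF \<theta>, of "\<pi> z" "\<pi> z'"] coset_add[OF sub, of z z'] z that by simp
      also have "\<dots> = \<pi> (\<zero>\<^bsub>G\<^esub> \<oplus>\<^bsub>G\<^esub> \<zero>\<^bsub>G\<^esub>)"
        unfolding *[OF z] *[OF that] by (rule coset_add[OF sub M.zero_closed M.zero_closed])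
      finally show ?thesis using z that zero by simp
    qed
    show "a \<odot>\<^bsub>G\<^esub> z \<in> ?J" if a: "a \<in> carrier K" for a
      using op_centroid[OF \<theta> op_smult[OF op_id a] _ M.zero_closed *[OF z]] z a zero by simp
    show "\<lbrace>y, z\<rbrace>\<^bsub>G\<^esub> \<in> ?J" if y: "y \<in> carrier G" for y
      using op_centroid[OF \<theta> op_bracket[OF op_id y] _ M.zero_closed *[OF z]] z y zero by simp
  qed auto
  then have "?J = \<mm>" using ideal_cases mJ x by blast
  then show ?thesis using y by blast
qed

text \<open>Inverses are obtained one vector at a time from the density lemma; sums, products and
  negatives are checked directly to lie in the centroid.\<close>

lemma division_action_centroid: "division_action (centroid K Q) (over_centroid Q)"
proof -
  interpret Q: lie_algebra K Q by (rule lie_algebra_quotient)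
  have simps: "carrier (over_centroid Q) = carrier Q" "add (over_centroid Q) = add Q"
    "zero (over_centroid Q) = zero Q" "\<And>\<theta> X. \<theta> \<odot>\<^bsub>over_centroid Q\<^esub> X = \<theta> X"
    by (auto simp: over_centroid_def)
  interpret O: abelian_group "over_centroid Q"
    by (rule abelian_groupI; unfold simps; rule abelian_groupE[OF Q.M.abelian_group_axioms]; assumption)
  \<comment> \<open>The inverse is defined relative to the whole record, so it has to be identified
    across the two structures.\<close>
  have inv: "\<ominus>\<^bsub>over_centroid Q\<^esub> X = \<ominus>\<^bsub>Q\<^esub> X" if "X \<in> carrier Q" for X
    by (rule O.minus_equality) (use that Q.M.l_neg[OF that] in \<open>simp_all add: simps\<close>)
  show ?thesis
  proof
    fix \<theta> X assume \<theta>: "\<theta> \<in> L" and "X \<in> carrier (over_centroid Q)"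
    then have X: "X \<in> carrier Q" by (simp add: simps)
    show "\<theta> \<odot>\<^bsub>over_centroid Q\<^esub> X \<in> carrier (over_centroid Q)"
      using centroidD(1)[OF \<theta> X] by (simp add: simps)
    show "\<exists>\<phi>\<in>L. \<phi> \<odot>\<^bsub>over_centroid Q\<^esub> (\<theta> \<odot>\<^bsub>over_centroid Q\<^esub> X) = X"
      if "\<theta> \<odot>\<^bsub>over_centroid Q\<^esub> X \<noteq> \<zero>\<^bsub>over_centroid Q\<^esub>"
    proof -
      have nz: "\<theta> X \<noteq> \<mm>" using that by (simp add: simps)
      obtain x where x: "x \<in> carrier G" "X = \<pi> x" using X by (auto simp: carrier_quotient)
      obtain y where y: "y \<in> carrier G" "\<theta> X = \<pi> y"
        using centroidD(1)[OF \<theta> X] by (auto simp: carrier_quotient)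
      \<comment> \<open>An operator killing y modulo \<open>\<mm>\<close> kills the image of f x
        under \<open>\<theta>\<close>, and \<open>\<theta>\<close> is injective. Hence the
        annihilator of y is contained in that of x, and density yields a centroid element taking the
        class of y back to that of x.\<close>
      have "f x \<in> \<mm>" if f: "f \<in> mult_ops K G" "f y \<in> \<mm>" for f
      proof (rule centroid_kernel[OF \<theta> x(1)])
        show "\<theta> (\<pi> x) \<noteq> \<mm>" using nz x by simp
        show "\<theta> (\<pi> (f x)) = \<mm>"
          using op_centroid[OF \<theta> f(1) x(1) y(1)] x y f \<pi>_eq_iff[of "f y"] by simp
      qed (use f x in simp)
      then show ?thesis using density[OF x(1) y(1)] x y by (simp add: simps)
    qed
  next
    fix \<theta> X Y assume "\<theta> \<in> L" "X \<in> carrier (over_centroid Q)" "Y \<in> carrier (over_centroid Q)"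
    then show "\<theta> \<odot>\<^bsub>over_centroid Q\<^esub> (X \<oplus>\<^bsub>over_centroid Q\<^esub> Y) =
        \<theta> \<odot>\<^bsub>over_centroid Q\<^esub> X \<oplus>\<^bsub>over_centroid Q\<^esub> \<theta> \<odot>\<^bsub>over_centroid Q\<^esub> Y"
      using centroidD(2) by (simp add: simps)
  next
    have "(\<lambda>X\<in>carrier Q. X) \<in> L" by (rule centroidI) auto
    then show "\<exists>\<epsilon>\<in>L. \<forall>X\<in>carrier (over_centroid Q). \<epsilon> \<odot>\<^bsub>over_centroid Q\<^esub> X = X"
      unfolding simps by (intro bexI[of _ "\<lambda>X\<in>carrier Q. X"]) simp_all
  next
    have "(\<lambda>X\<in>carrier Q. \<ominus>\<^bsub>Q\<^esub> X) \<in> L"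
      by (rule centroidI) (auto simp: Q.M.minus_add Q.smult_r_minus Q.bracket_minus)
    then show "\<exists>\<epsilon>\<in>L. \<forall>X\<in>carrier (over_centroid Q). \<epsilon> \<odot>\<^bsub>over_centroid Q\<^esub> X = \<ominus>\<^bsub>over_centroid Q\<^esub> X"
      unfolding simps by (intro bexI[of _ "\<lambda>X\<in>carrier Q. \<ominus>\<^bsub>Q\<^esub> X"]) (simp_all add: inv)
  next
    fix \<theta> \<phi> assume \<theta>: "\<theta> \<in> L" and \<phi>: "\<phi> \<in> L"
    note D = centroidD[OF \<theta>] centroidD[OF \<phi>]
    have "(\<lambda>X\<in>carrier Q. \<theta> X \<oplus>\<^bsub>Q\<^esub> \<phi> X) \<in> L"
      by (rule centroidI) (simp_all add: D Q.M.a_ac Q.smult_r_distr Q.bracket_add_right)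
    then show "\<exists>\<psi>\<in>L. \<forall>X\<in>carrier (over_centroid Q). \<psi> \<odot>\<^bsub>over_centroid Q\<^esub> X =
        \<theta> \<odot>\<^bsub>over_centroid Q\<^esub> X \<oplus>\<^bsub>over_centroid Q\<^esub> \<phi> \<odot>\<^bsub>over_centroid Q\<^esub> X"
      unfolding simps by (intro bexI[of _ "\<lambda>X\<in>carrier Q. \<theta> X \<oplus>\<^bsub>Q\<^esub> \<phi> X"]) simp_all
    have "(\<lambda>X\<in>carrier Q. \<theta> (\<phi> X)) \<in> L"
      by (rule centroidI) (simp_all add: D)
    then show "\<exists>\<psi>\<in>L. \<forall>X\<in>carrier (over_centroid Q). \<psi> \<odot>\<^bsub>over_centroid Q\<^esub> X =
        \<theta> \<odot>\<^bsub>over_centroid Q\<^esub> (\<phi> \<odot>\<^bsub>over_centroid Q\<^esub> X)"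
      unfolding simps by (intro bexI[of _ "\<lambda>X\<in>carrier Q. \<theta> (\<phi> X)"]) simp_all
  qed
qed

end

section \<open>Rank of operators over the centroid\<close>

context simple_quotient
begin

text \<open>The image set is the kernel of the map induced by f on the quotient, so its codimension
  over the centroid is the rank of that map. With kernels, lowering the rank by one amounts to
  adjoining one vector.\<close>

definition corank_le :: "nat \<Rightarrow> ('b \<Rightarrow> 'b) \<Rightarrow> bool" where
  "corank_le n f \<longleftrightarrow>
     division_action.codim_le (centroid K Q) (over_centroid Q) n (\<pi> ` {x \<in> carrier G. f x \<in> \<mm>})"

interpretation D: division_action "centroid K Q" "over_centroid Q"
  by (rule division_action_centroid)

lemma over_centroid_simps:
  "carrier (over_centroid Q) = carrier Q" "add (over_centroid Q) = add Q"
  "zero (over_centroid Q) = \<mm>" "\<theta> \<odot>\<^bsub>over_centroid Q\<^esub> X = \<theta> X"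
  by (auto simp: over_centroid_def)

lemma mem_kernel_image:
  assumes "f \<in> mult_ops K G" "x \<in> carrier G"
  shows "\<pi> x \<in> \<pi> ` {x \<in> carrier G. f x \<in> \<mm>} \<longleftrightarrow> f x \<in> \<mm>"
proof
  assume "\<pi> x \<in> \<pi> ` {x \<in> carrier G. f x \<in> \<mm>}"
  then obtain y where y: "y \<in> carrier G" "f y \<in> \<mm>" "\<pi> x = \<pi> y" by blast
  have "\<pi> (f x) = \<pi> (f y)" using op_coset_cong[OF ideal assms(1,2) y(1,3)] .
  then show "f x \<in> \<mm>" using \<pi>_eq_iff[of "f x"] \<pi>_eq_iff[of "f y"] assms y by simp
qed (use assms in blast)

lemma subspace_kernel_image:
  assumes f: "f \<in> mult_ops K G"
  shows "D.subspace (\<pi> ` {x \<in> carrier G. f x \<in> \<mm>})"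
  unfolding D.subspace_def over_centroid_simps
proof (intro conjI ballI)
  have zero: "\<pi> \<zero>\<^bsub>G\<^esub> = \<mm>" using \<pi>_eq_iff[of "\<zero>\<^bsub>G\<^esub>"] submodule_zero[OF sub] by simp
  show "\<pi> ` {x \<in> carrier G. f x \<in> \<mm>} \<subseteq> carrier Q" by blast
  have "f \<zero>\<^bsub>G\<^esub> \<in> \<mm>" using op_ideal[OF ideal f submodule_zero[OF sub]] .
  then show "\<mm> \<in> \<pi> ` {x \<in> carrier G. f x \<in> \<mm>}"
    using mem_kernel_image[OF f M.zero_closed] zero by simp
  fix X assume "X \<in> \<pi> ` {x \<in> carrier G. f x \<in> \<mm>}"
  then obtain x where x: "x \<in> carrier G" "f x \<in> \<mm>" "X = \<pi> x" by blast
  show "X \<oplus>\<^bsub>Q\<^esub> Y \<in> \<pi> ` {x \<in> carrier G. f x \<in> \<mm>}"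
    if Y: "Y \<in> \<pi> ` {x \<in> carrier G. f x \<in> \<mm>}" for Y
  proof -
    obtain y where y: "y \<in> carrier G" "f y \<in> \<mm>" "Y = \<pi> y" using Y by blast
    have "f (x \<oplus>\<^bsub>G\<^esub> y) \<in> \<mm>" using op_plus[OF f x(1) y(1)] submoduleE(5)[OF sub x(2) y(2)] by simp
    then show ?thesis using mem_kernel_image[OF f, of "x \<oplus>\<^bsub>G\<^esub> y"] x y coset_add[OF sub x(1) y(1)]
      by simp
  qed
  show "\<theta> X \<in> \<pi> ` {x \<in> carrier G. f x \<in> \<mm>}" if \<theta>: "\<theta> \<in> L" for \<theta>
  proof -
    obtain y where y: "y \<in> carrier G" "\<theta> X = \<pi> y"
      using centroidD(1)[OF \<theta>, of X] x by (auto simp: carrier_quotient)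
    have "\<pi> (f x) = \<mm>" using \<pi>_eq_iff[of "f x"] x f by simp
    then have "\<pi> (f y) = \<mm>"
      using op_centroid[OF \<theta> f x(1) y(1)] y x centroid_zero[OF \<theta>] by simp
    then show ?thesis using mem_kernel_image[OF f y(1)] \<pi>_eq_iff[of "f y"] f y by simp
  qed
qed

text \<open>The identity has zero kernel, so a basis over the centroid provides the starting bound
  of the descent.\<close>

lemma corank_le_id:
  assumes "has_dim (centroid K Q) (over_centroid Q) d"
  shows "corank_le d (\<lambda>x. x)"
proof -
  obtain B where B: "is_basis (centroid K Q) (over_centroid Q) B" "finite B" "card B = d"
    using assms by (auto simp: has_dim_def)
  have "D.codim_le d {\<mm>}" using D.codim_le_is_basis[OF B(1,2)] B(3) by (simp add: over_centroid_simps)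
  moreover have "\<mm> \<in> \<pi> ` {x \<in> carrier G. x \<in> \<mm>}"
    using subspace_kernel_image[OF op_id] by (simp add: D.subspace_def over_centroid_simps)
  ultimately show ?thesis unfolding corank_le_def
    using D.codim_le_mono[of d "{\<mm>}"] by simp
qed

lemma corank_le_0:
  assumes "corank_le 0 f" "f \<in> mult_ops K G" "x \<in> carrier G"
  shows "f x \<in> \<mm>"
proof -
  have "carrier Q \<subseteq> \<pi> ` {x \<in> carrier G. f x \<in> \<mm>}"
    using assms(1) by (simp add: corank_le_def over_centroid_simps)
  then show ?thesis using mem_kernel_image[OF assms(2,3)] assms(3) by blast
qed

lemma corank_le_annihilated:
  assumes "\<And>x. x \<in> carrier G \<Longrightarrow> f x \<in> \<mm>"
  shows "corank_le n f"
proof -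
  have eq: "\<pi> ` {x \<in> carrier G. f x \<in> \<mm>} = carrier Q"
    using assms by (auto simp: carrier_quotient)
  have "D.codim_le n (carrier Q)"
  proof (induction n)
    case (Suc n)
    then show ?case using D.codim_le_Suc[OF Suc] by (simp only: over_centroid_simps subset_refl)
  qed (simp add: over_centroid_simps)
  then show ?thesis by (simp add: corank_le_def eq)
qed

text \<open>The kernel of h contains that of f and also v, which lies outside the kernel of f; by
  exchange this gains one dimension.\<close>

lemma corank_le_step:
  assumes f: "f \<in> mult_ops K G" "corank_le (Suc n) f" and h: "h \<in> mult_ops K G"
    and le: "\<And>x. x \<in> carrier G \<Longrightarrow> f x \<in> \<mm> \<Longrightarrow> h x \<in> \<mm>"
    and v: "v \<in> carrier G" "f v \<notin> \<mm>" "h v \<in> \<mm>"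
  shows "corank_le n h"
proof -
  let ?f = "\<pi> ` {x \<in> carrier G. f x \<in> \<mm>}" and ?h = "\<pi> ` {x \<in> carrier G. h x \<in> \<mm>}"
  have "D.codim_le n (D.adjoin ?f (\<pi> v))"
  proof (rule D.codim_le_exchange[OF _ subspace_kernel_image[OF f(1)]])
    show "D.codim_le (Suc n) ?f" using f(2) by (simp only: corank_le_def)
    show "\<pi> v \<notin> ?f" using mem_kernel_image[OF f(1) v(1)] v(2) by blast
    show "\<pi> v \<in> carrier (over_centroid Q)" using v by (simp add: over_centroid_simps)
  qed
  moreover have "D.adjoin ?f (\<pi> v) \<subseteq> ?h"
  proof (rule D.adjoin_subset[OF subspace_kernel_image[OF h]])
    show "\<pi> v \<in> ?h" using mem_kernel_image[OF h v(1)] v(3) by blast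
    show "?f \<subseteq> ?h" using le by blast
  qed
  ultimately show ?thesis unfolding corank_le_def by (rule D.codim_le_mono)
qed

end

section \<open>The rank-lowering contraction\<close>

context lie_algebra
begin

text \<open>Contracting \<open>f z \<and> f v\<close> by \<open>B\<close> lowers the corank of \<open>f\<close>, simultaneously modulo all ideals.\<close>

definition drop_op :: "('b \<Rightarrow> 'b) \<Rightarrow> 'b \<Rightarrow> ('b \<Rightarrow> 'b) \<Rightarrow> 'b \<Rightarrow> 'b" where
  "drop_op f v B = (\<lambda>z. \<lbrace>B (f v), f z\<rbrace>\<^bsub>G\<^esub> \<oplus>\<^bsub>G\<^esub> \<lbrace>f v, B (f z)\<rbrace>\<^bsub>G\<^esub>)"

lemma drop_op_mult_ops:
  assumes "f \<in> mult_ops K G" "B \<in> mult_ops K G" "v \<in> carrier G"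
  shows "drop_op f v B \<in> mult_ops K G"
proof -
  have c: "f v \<in> carrier G" "B (f v) \<in> carrier G" using assms by auto
  show ?thesis
    unfolding drop_op_def
    by (rule op_add[OF op_bracket[OF assms(1) c(2)] op_bracket[OF op_comp[OF assms(2,1)] c(1)]])
qed

text \<open>For z = v the two terms are [B (f v), f v] and [f v, B (f v)], which cancel by
  antisymmetry. The identity holds in G, hence modulo all ideals.\<close>

lemma drop_op_self:
  assumes "f \<in> mult_ops K G" "B \<in> mult_ops K G" "v \<in> carrier G"
  shows "drop_op f v B v = \<zero>\<^bsub>G\<^esub>"
  using bracket_anti[of "B (f v)" "f v"] assms by (simp add: drop_op_def M.l_neg)

text \<open>Each term contains f v and f x once, possibly under B, and ideals are stable under B and
  under brackets. The case of f x gives the inclusion of kernels, the case of f v the vanishing of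
  the whole operator.\<close>

lemma drop_op_ideal:
  assumes I: "lie_ideal K G I" and f: "f \<in> mult_ops K G" and B: "B \<in> mult_ops K G"
    and v: "v \<in> carrier G" and x: "x \<in> carrier G" and or: "f v \<in> I \<or> f x \<in> I"
  shows "drop_op f v B x \<in> I"
proof -
  have "\<lbrace>B (f v), f x\<rbrace>\<^bsub>G\<^esub> \<in> I" "\<lbrace>f v, B (f x)\<rbrace>\<^bsub>G\<^esub> \<in> I"
    using or lie_idealD(2,3)[OF I] op_ideal[OF I B] f B v x by auto
  then show ?thesis unfolding drop_op_def by (rule submoduleE(5)[OF lie_idealD(1)[OF I]])
qed

end

context simple_quotient
begin

text \<open>Since v will be chosen with another ideal in mind, f v may lie in \<open>\<mm>\<close>.
  Then the contraction vanishes modulo \<open>\<mm>\<close> and any rank bound holds; otherwise v is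
  the additional kernel vector.\<close>

lemma corank_le_drop_op:
  assumes f: "f \<in> mult_ops K G" "corank_le (Suc n) f" and B: "B \<in> mult_ops K G"
    and v: "v \<in> carrier G"
  shows "corank_le n (drop_op f v B)"
proof (cases "f v \<in> \<mm>")
  case True
  then show ?thesis using drop_op_ideal[OF ideal f(1) B v] by (intro corank_le_annihilated) blast
next
  case False
  show ?thesis
  proof (rule corank_le_step[OF f drop_op_mult_ops[OF f(1) B v] _ v False])
    show "drop_op f v B v \<in> \<mm>" using drop_op_self[OF f(1) B v] submodule_zero[OF sub] by simp
  qed (use drop_op_ideal[OF ideal f(1) B v] in blast)
qed

text \<open>The operator is found so that the second term of the contraction dies modulo
  \<open>\<mm>\<close> while the first survives: it has to kill f x and to move f v to an element
  whose bracket with f x is outside \<open>\<mm>\<close>.\<close>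

lemma drop_op_nonzero:
  assumes f: "f \<in> mult_ops K G" and x: "x \<in> carrier G" and v: "v \<in> carrier G"
    and comm: "\<lbrace>f x, f v\<rbrace>\<^bsub>G\<^esub> \<notin> \<mm>"
  shows "\<exists>B\<in>mult_ops K G. drop_op f v B x \<notin> \<mm>"
proof -
  have c: "f x \<in> carrier G" "f v \<in> carrier G" using f x v by auto
  \<comment> \<open>Were there no such B, density would make the class of f v a centroid multiple of
    that of f x. Then [f x, f v] would be the image of [f x, f x] = 0, against
    \<open>comm\<close>.\<close>
  have "\<exists>B\<in>mult_ops K G. B (f x) \<in> \<mm> \<and> B (f v) \<notin> \<mm>"
  proof (rule ccontr)
    assume "\<not> ?thesis"
    then obtain \<theta> where \<theta>: "\<theta> \<in> L" "\<theta> (\<pi> (f x)) = \<pi> (f v)" using density[OF c(2,1)] by blast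
    have "\<theta> (\<pi> \<lbrace>f x, f x\<rbrace>\<^bsub>G\<^esub>) = \<pi> \<lbrace>f x, f v\<rbrace>\<^bsub>G\<^esub>"
      using op_centroid[OF \<theta>(1) op_bracket[OF op_id c(1)] c \<theta>(2)] .
    moreover have "\<pi> \<zero>\<^bsub>G\<^esub> = \<mm>" using \<pi>_eq_iff[of "\<zero>\<^bsub>G\<^esub>"] submodule_zero[OF sub] by simp
    ultimately have "\<pi> \<lbrace>f x, f v\<rbrace>\<^bsub>G\<^esub> = \<mm>" using c centroid_zero[OF \<theta>(1)] by simp
    then show False using comm \<pi>_eq_iff c by simp
  qed
  then obtain B where B: "B \<in> mult_ops K G" "B (f x) \<in> \<mm>" "B (f v) \<notin> \<mm>" by blast
  have "f x \<notin> \<mm>" using comm lie_idealD(3)[OF ideal c(2)] by blast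
  then obtain y where y: "y \<in> carrier G" "\<lbrace>y, f x\<rbrace>\<^bsub>G\<^esub> \<notin> \<mm>" using bracket_notin[OF c(1)] by blast
  have Bv: "B (f v) \<in> carrier G" using B c by simp
  obtain A where A: "A \<in> mult_ops K G" "\<pi> y = \<pi> (A (B (f v)))"
    using op_transitive[OF Bv B(3) y(1)] by blast
  \<comment> \<open>A carries B (f v) to y modulo \<open>\<mm>\<close> and preserves
    \<open>\<mm>\<close>, so the composite still kills f x.\<close>
  define C where "C = (\<lambda>z. A (B z))"
  have C: "C \<in> mult_ops K G" unfolding C_def by (rule op_comp[OF A(1) B(1)])
  have Cv: "C (f v) \<in> carrier G" using C c by simp
  have "\<pi> \<lbrace>y, f x\<rbrace>\<^bsub>G\<^esub> = \<pi> \<lbrace>C (f v), f x\<rbrace>\<^bsub>G\<^esub>"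
    using coset_bracket[OF ideal y(1) c(1)] coset_bracket[OF ideal Cv c(1)] A(2) by (simp add: C_def)
  then have 1: "\<lbrace>C (f v), f x\<rbrace>\<^bsub>G\<^esub> \<notin> \<mm>" using y c Cv \<pi>_eq_iff by (metis bracket_closed)
  have "C (f x) \<in> \<mm>" unfolding C_def using op_ideal[OF ideal A(1) B(2)] .
  then have 2: "\<lbrace>f v, C (f x)\<rbrace>\<^bsub>G\<^esub> \<in> \<mm>" using lie_idealD(2)[OF ideal c(2)] by blast
  have "drop_op f v C x \<notin> \<mm>"
  proof
    assume "drop_op f v C x \<in> \<mm>"
    then have "drop_op f v C x \<oplus>\<^bsub>G\<^esub> \<ominus>\<^bsub>G\<^esub> \<lbrace>f v, C (f x)\<rbrace>\<^bsub>G\<^esub> \<in> \<mm>"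
      using submoduleE(3,5)[OF sub] 2 by blast
    moreover have "drop_op f v C x \<oplus>\<^bsub>G\<^esub> \<ominus>\<^bsub>G\<^esub> \<lbrace>f v, C (f x)\<rbrace>\<^bsub>G\<^esub> = \<lbrace>C (f v), f x\<rbrace>\<^bsub>G\<^esub>"
      using C c Cv by (simp add: drop_op_def M.a_assoc M.r_neg)
    ultimately show False using 1 by simp
  qed
  then show ?thesis using C by blast
qed

end

section \<open>Infinitely many ideals contradict weak Noetherianity\<close>

context lie_algebra
begin

lemma bracket_coset_cong:
  assumes I: "lie_ideal K G I" and x: "x \<in> carrier G" "x' \<in> carrier G" "coset I x = coset I x'"
    and y: "y \<in> carrier G" "y' \<in> carrier G" "coset I y = coset I y'"
  shows "\<lbrace>x, y\<rbrace>\<^bsub>G\<^esub> \<in> I \<longleftrightarrow> \<lbrace>x', y'\<rbrace>\<^bsub>G\<^esub> \<in> I"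
proof -
  have "coset I \<lbrace>x, y\<rbrace>\<^bsub>G\<^esub> = coset I \<lbrace>x', y'\<rbrace>\<^bsub>G\<^esub>"
    using coset_bracket[OF I x(1) y(1)] coset_bracket[OF I x(2) y(2)] x(3) y(3) by simp
  then show ?thesis
    using coset_eq_self_iff[OF lie_idealD(1)[OF I], of "\<lbrace>x, y\<rbrace>\<^bsub>G\<^esub>"]
      coset_eq_self_iff[OF lie_idealD(1)[OF I], of "\<lbrace>x', y'\<rbrace>\<^bsub>G\<^esub>"] x y by simp
qed

lemma mem_coset_cong:
  assumes I: "submodule I K G" and x: "x \<in> carrier G" "x' \<in> carrier G" "coset I x = coset I x'"
  shows "x \<in> I \<longleftrightarrow> x' \<in> I"
  using coset_eq_self_iff[OF I x(1)] coset_eq_self_iff[OF I x(2)] x(3) by simp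

text \<open>It suffices to find one element outside \<open>\<mm>\<close> that lies in all ideals of
  \<open>F\<close>: an operator then moves it to x modulo \<open>\<mm>\<close> and preserves
  membership in the other ideals.\<close>

lemma chinese_remainder:
  assumes "finite F" "\<And>p. p \<in> F \<Longrightarrow> simple_quotient K G p" "simple_quotient K G \<mm>" "\<mm> \<notin> F"
    and "x \<in> carrier G"
  shows "\<exists>y\<in>carrier G. coset \<mm> y = coset \<mm> x \<and> (\<forall>p\<in>F. y \<in> p)"
  using assms
proof (induction F arbitrary: x)
  case (insert p F)
  interpret m: simple_quotient K G \<mm> by (rule insert.prems(2))
  interpret p: simple_quotient K G p by (rule insert.prems(1)) simp
  have good: "lie_ideal K G q" if "q \<in> insert p F" for q
    using simple_quotient.ideal[OF insert.prems(1)[OF that]] .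
  obtain u where u: "u \<in> carrier G" "u \<notin> \<mm>" using m.proper by blast
  then obtain v where v: "v \<in> carrier G" "\<lbrace>v, u\<rbrace>\<^bsub>G\<^esub> \<notin> \<mm>" using m.bracket_notin by blast
  obtain y where y: "y \<in> carrier G" "coset \<mm> y = coset \<mm> v" "\<forall>q\<in>F. y \<in> q"
    using insert.IH[OF insert.prems(1) insert.prems(2) _ v(1)] insert.prems(3) by auto
  \<comment> \<open>Both ideals are maximal and distinct, so neither contains the other.\<close>
  have "\<not> p \<subseteq> \<mm>"
    using p.ideal_cases[OF m.ideal] m.proper insert.prems(3) by blast
  then obtain w where w: "w \<in> p" "w \<notin> \<mm>" by blast
  have wG: "w \<in> carrier G" using w p.proper by blast
  obtain f where f: "f \<in> mult_ops K G" "coset \<mm> u = coset \<mm> (f w)"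
    using m.op_transitive[OF wG w(2) u(1)] by blast
  have fw: "f w \<in> p" "f w \<in> carrier G" using op_ideal[OF p.ideal f(1) w(1)] f wG by auto
  \<comment> \<open>The factor y lies in all ideals of \<open>F\<close> and the factor f w in p, so
    the bracket lies in all of them. Modulo \<open>\<mm>\<close> it is [v, u], which was chosen
    nonzero.\<close>
  define z where "z = \<lbrace>y, f w\<rbrace>\<^bsub>G\<^esub>"
  have z: "z \<in> carrier G" "z \<notin> \<mm>"
    using bracket_coset_cong[OF m.ideal y(1) v(1) y(2) fw(2) u(1) f(2)[symmetric]] v(2) y(1) fw(2)
    by (auto simp: z_def)
  have zq: "z \<in> q" if q: "q \<in> insert p F" for q
    using lie_idealD(2)[OF good[OF q] y(1), of "f w"] lie_idealD(3)[OF good[OF q] fw(2), of y]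
      q y(3) fw(1) by (auto simp: z_def)
  obtain g where g: "g \<in> mult_ops K G" "coset \<mm> x = coset \<mm> (g z)"
    using m.op_transitive[OF z insert.prems(4)] by blast
  have "\<forall>q\<in>insert p F. g z \<in> q" using op_ideal[OF good g(1) zq] by blast
  then show ?case using g z by (intro bexI[of _ "g z"]) auto
qed auto

text \<open>The subalgebra H is the intersection of all A p + p. Its derived algebra lies in every
  p, so each H \<inter> p survives as a subspace of the abelianization of H, and separating elements
  for arbitrarily large finite F make the abelianization infinite-dimensional.\<close>

lemma weakly_noetherian_contradiction:
  assumes wn: "weakly_noetherian K G" and inf: "infinite S"
    and ideal: "\<And>p. p \<in> S \<Longrightarrow> lie_ideal K G p"
    and A: "\<And>p. p \<in> S \<Longrightarrow> submodule (A p) K G"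
    and comm: "\<And>p x y. \<lbrakk>p \<in> S; x \<in> A p; y \<in> A p\<rbrakk> \<Longrightarrow> \<lbrace>x, y\<rbrace>\<^bsub>G\<^esub> \<in> p"
    and sep: "\<And>F p. \<lbrakk>finite F; F \<subseteq> S; p \<in> F\<rbrakk> \<Longrightarrow> \<exists>x\<in>carrier G.
        (\<forall>q\<in>S. \<exists>y\<in>A q. coset q x = coset q y) \<and> x \<notin> p \<and> (\<forall>q\<in>F - {p}. x \<in> q)"
  shows False
proof -
  define H where "H = {x \<in> carrier G. \<forall>p\<in>S. \<exists>y\<in>A p. coset p x = coset p y}"
  have AG: "y \<in> carrier G" if "p \<in> S" "y \<in> A p" for p y
    using submoduleE(1)[OF A] that by blast
  have W: "submodule {x \<in> carrier G. \<exists>y\<in>A p. coset p x = coset p y} K G" if "p \<in> S" for p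
    using submodule_sum[OF ideal[OF that] A[OF that]] .
  have HW: "H = {x \<in> carrier G. \<forall>p\<in>S. x \<in> {x \<in> carrier G. \<exists>y\<in>A p. coset p x = coset p y}}"
    by (auto simp: H_def)
  have Hsub: "submodule H K G"
  proof (rule submoduleI)
    show "H \<subseteq> carrier G" by (auto simp: H_def)
    show "\<zero>\<^bsub>G\<^esub> \<in> H" unfolding HW using submodule_zero[OF W] by blast
    fix x assume x: "x \<in> H"
    then have xG: "x \<in> carrier G" by (simp add: H_def)
    show "\<ominus>\<^bsub>G\<^esub> x \<in> H" unfolding HW using submoduleE(3)[OF W, of _ x] x xG HW by blast
    show "a \<odot>\<^bsub>G\<^esub> x \<in> H" if "a \<in> carrier K" for a
      unfolding HW using submoduleE(4)[OF W, of _ a x] x xG HW that by blast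
    show "x \<oplus>\<^bsub>G\<^esub> y \<in> H" if "y \<in> H" for y
      unfolding HW using submoduleE(5)[OF W, of _ x y] x xG HW that by blast
  qed
  have HG: "x \<in> carrier G" if "x \<in> H" for x using that by (simp add: H_def)
  have Hcomm: "\<lbrace>x, y\<rbrace>\<^bsub>G\<^esub> \<in> p" if x: "x \<in> H" and y: "y \<in> H" and p: "p \<in> S" for x y p
  proof -
    obtain x' where x': "x' \<in> A p" "coset p x = coset p x'" using x p by (auto simp: H_def)
    obtain y' where y': "y' \<in> A p" "coset p y = coset p y'" using y p by (auto simp: H_def)
    show ?thesis
      using bracket_coset_cong[OF ideal[OF p] HG[OF x] AG[OF p x'(1)] x'(2) HG[OF y] AG[OF p y'(1)] y'(2)]
        comm[OF p x'(1) y'(1)] by blast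
  qed
  \<comment> \<open>Applied to brackets, which lie in every p by \<open>Hcomm\<close>, this gives
    closure of H under the bracket.\<close>
  have pH: "x \<in> H" if "x \<in> carrier G" "\<forall>p\<in>S. x \<in> p" for x
  proof -
    have "coset p x = coset p \<zero>\<^bsub>G\<^esub>" if p: "p \<in> S" for p
      using coset_eq_self_iff[OF lie_idealD(1)[OF ideal[OF p]]]
        submodule_zero[OF lie_idealD(1)[OF ideal[OF p]]] \<open>x \<in> carrier G\<close> \<open>\<forall>p\<in>S. x \<in> p\<close> p
      by (metis M.zero_closed)
    then show ?thesis using submodule_zero[OF A] \<open>x \<in> carrier G\<close> unfolding H_def by blast
  qed
  have "lie_subalgebra K G H" unfolding lie_subalgebra_def
  proof (intro conjI ballI Hsub)
    fix x y assume "x \<in> H" "y \<in> H"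
    then show "\<lbrace>x, y\<rbrace>\<^bsub>G\<^esub> \<in> H" using HG Hcomm by (intro pH) auto
  qed
  define GH where "GH = G\<lparr>carrier := H\<rparr>"
  interpret H: lie_algebra K GH
    unfolding GH_def using lie_algebra_subalgebra[OF \<open>lie_subalgebra K G H\<close>] .
  have GH: "carrier GH = H" "zero GH = zero G" "add GH = add G" "smult GH = smult G"
    "bracket GH = bracket G"
    by (auto simp: GH_def)
  define D where "D = derived_subalgebra K GH"
  have N: "submodule (H \<inter> p) K GH" if p: "p \<in> S" for p
  proof -
    note ps = lie_idealD(1)[OF ideal[OF p]]
    have s: "a \<odot>\<^bsub>G\<^esub> x \<in> H \<inter> p" if "a \<in> carrier K" "x \<in> H \<inter> p" for a x
      using submoduleE(4)[OF Hsub that(1)] submoduleE(4)[OF ps that(1)] that(2) by blast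
    show ?thesis
    proof (rule H.submoduleI)
      show "\<ominus>\<^bsub>GH\<^esub> x \<in> H \<inter> p" if x: "x \<in> H \<inter> p" for x
      proof -
        \<comment> \<open>The additive inverse of \<open>GH\<close> is taken relative to the carrier
          H; the scalar -1 acts the same in \<open>GH\<close> and in G, so it serves as the
          bridge.\<close>
        have "\<ominus>\<^bsub>GH\<^esub> x = (\<ominus> \<one>) \<odot>\<^bsub>GH\<^esub> x"
          using H.smult_l_minus[of \<one> x] H.smult_one[of x] x by (simp add: GH(1))
        then show ?thesis using s[of "\<ominus> \<one>" x] x by (simp add: GH)
      qed
    qed (use s submoduleE(5)[OF ps] submoduleE(5)[OF Hsub] submodule_zero[OF ps]
        submodule_zero[OF Hsub] in \<open>auto simp: GH\<close>)
  qed
  have Dsub: "submodule D K GH" unfolding D_def derived_subalgebra_def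
    by (rule H.submodule_lin_span) (use H.bracket_closed in auto)
  have Dp: "D \<subseteq> H \<inter> p" if p: "p \<in> S" for p
    unfolding D_def derived_subalgebra_def
  proof (rule H.lin_span_subset[OF N[OF p]])
    show "{\<lbrace>x, y\<rbrace>\<^bsub>GH\<^esub> |x y. x \<in> carrier GH \<and> y \<in> carrier GH} \<subseteq> H \<inter> p"
      using H.bracket_closed Hcomm[OF _ _ p] by (auto simp: GH)
  qed
  have "fin_dim K (GH LieQuot D)"
    using wn \<open>lie_subalgebra K G H\<close> by (simp add: weakly_noetherian_def GH_def D_def)
  then obtain B where B: "is_basis K (GH LieQuot D) B" "finite B"
    by (auto simp: fin_dim_def has_dim_def)
  interpret V: division_action K "GH LieQuot D" by (rule H.division_action_quotient[OF Dsub])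
  \<comment> \<open>One more ideal than the dimension of the abelianization.\<close>
  obtain F where F: "finite F" "card F = Suc (card B)" "F \<subseteq> S"
    using infinite_arbitrarily_large[OF inf] by blast
  let ?M = "\<lambda>p. H.coset D ` (H \<inter> p)"
  show False
  proof (rule V.codim_le_independent[OF V.codim_le_is_basis[OF B] V.subspace_zero_set F(1,2)])
    fix p assume pF: "p \<in> F"
    then have p: "p \<in> S" using F by blast
    have zero: "\<zero>\<^bsub>GH LieQuot D\<^esub> = H.coset D \<zero>\<^bsub>GH\<^esub>"
      using H.coset_eq_self_iff[OF Dsub H.M.zero_closed] H.submodule_zero[OF Dsub] by simp
    show sub: "V.subspace (?M p)"
      unfolding V.subspace_def
    proof (intro conjI ballI)
      show "?M p \<subseteq> carrier (GH LieQuot D)" by (auto simp: H.carrier_quotient GH(1))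
      show "\<zero>\<^bsub>GH LieQuot D\<^esub> \<in> ?M p" unfolding zero using H.submodule_zero[OF N[OF p]] by blast
      fix X assume "X \<in> ?M p"
      then obtain x where x: "x \<in> H \<inter> p" "X = H.coset D x" "x \<in> carrier GH" using GH(1) by auto
      show "X \<oplus>\<^bsub>GH LieQuot D\<^esub> Y \<in> ?M p" if Y: "Y \<in> ?M p" for Y
      proof -
        obtain y where y: "y \<in> H \<inter> p" "Y = H.coset D y" "y \<in> carrier GH" using Y GH(1) by auto
        show ?thesis unfolding x(2) y(2) H.coset_add[OF Dsub x(3) y(3)]
          by (intro imageI H.submoduleE(5)[OF N[OF p] x(1) y(1)])
      qed
      show "a \<odot>\<^bsub>GH LieQuot D\<^esub> X \<in> ?M p" if a: "a \<in> carrier K" for a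
        unfolding x(2) H.coset_smult[OF Dsub a x(3)]
        by (intro imageI H.submoduleE(4)[OF N[OF p] a x(1)])
    qed
    show "{\<zero>\<^bsub>GH LieQuot D\<^esub>} \<subseteq> ?M p" using sub by (simp add: V.subspace_def)
    \<comment> \<open>Because D is contained in H \<inter> q, a class modulo D can be in the image
      of H \<inter> q only if all its representatives lie in q.\<close>
    have inM: "x \<in> q" if x: "x \<in> H" and q: "q \<in> S" and X: "H.coset D x \<in> ?M q" for x q
    proof -
      obtain x' where x': "x' \<in> H \<inter> q" "H.coset D x = H.coset D x'" using X by blast
      have c: "x \<in> carrier GH" "x' \<in> carrier GH" using x x' GH(1) by auto
      have "x \<ominus>\<^bsub>GH\<^esub> x' \<in> D" using H.coset_eq_iff[OF Dsub c] x'(2) by blast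
      then have "x \<ominus>\<^bsub>GH\<^esub> x' \<in> H \<inter> q" using Dp[OF q] by blast
      then have "(x \<ominus>\<^bsub>GH\<^esub> x') \<oplus>\<^bsub>GH\<^esub> x' \<in> H \<inter> q" using H.submoduleE(5)[OF N[OF q] _ x'(1)] by blast
      moreover have "(x \<ominus>\<^bsub>GH\<^esub> x') \<oplus>\<^bsub>GH\<^esub> x' = x"
        using c by (simp add: H.M.minus_eq H.M.a_assoc H.M.l_neg)
      ultimately show ?thesis by simp
    qed
    obtain x where x: "x \<in> carrier G" "\<forall>q\<in>S. \<exists>y\<in>A q. coset q x = coset q y" "x \<notin> p"
      "\<forall>q\<in>F - {p}. x \<in> q"
      using sep[OF F(1,3) pF] by blast
    then have xH: "x \<in> H" by (simp add: H_def)
    then have "x \<in> carrier GH" by (simp add: GH(1))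
    moreover have "H.coset D x \<notin> ?M p" using inM[OF xH p] x(3) by blast
    moreover have "\<forall>q\<in>F - {p}. H.coset D x \<in> ?M q" using x(4) xH by blast
    ultimately show "\<exists>X\<in>carrier (GH LieQuot D). X \<notin> ?M p \<and> (\<forall>q\<in>F - {p}. X \<in> ?M q)"
      by (intro bexI[of _ "H.coset D x"] conjI) auto
  qed
qed

section \<open>The two infinite configurations that weak Noetherianity forbids\<close>

lemma no_infinite_abelian_op:
  assumes wn: "weakly_noetherian K G" and inf: "infinite S"
    and S: "\<And>p. p \<in> S \<Longrightarrow> simple_quotient K G p"
    and f: "f \<in> mult_ops K G"
    and nz: "\<And>p. p \<in> S \<Longrightarrow> \<exists>x\<in>carrier G. f x \<notin> p"
    and comm: "\<And>p x y. \<lbrakk>p \<in> S; x \<in> carrier G; y \<in> carrier G\<rbrakk> \<Longrightarrow> \<lbrace>f x, f y\<rbrace>\<^bsub>G\<^esub> \<in> p"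
  shows False
proof (rule weakly_noetherian_contradiction[OF wn inf, where A = "\<lambda>_. f ` carrier G"])
  show ideal: "lie_ideal K G p" if "p \<in> S" for p
    using simple_quotient.ideal[OF S[OF that]] .
  have smult: "a \<odot>\<^bsub>G\<^esub> x \<in> f ` carrier G" if "a \<in> carrier K" "x \<in> f ` carrier G" for a x
    using that op_scale[OF f] by (metis (no_types, lifting) image_iff smult_closed)
  have sub: "submodule (f ` carrier G) K G"
  proof (rule submoduleI)
    show "f ` carrier G \<subseteq> carrier G" using f by auto
    show "\<zero>\<^bsub>G\<^esub> \<in> f ` carrier G"
      using smult[of \<zero> "f \<zero>\<^bsub>G\<^esub>"] f by simp
    show "\<ominus>\<^bsub>G\<^esub> x \<in> f ` carrier G" if "x \<in> f ` carrier G" for x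
      using smult[of "\<ominus> \<one>" x] that f by (auto simp: smult_l_minus)
    show "x \<oplus>\<^bsub>G\<^esub> y \<in> f ` carrier G" if "x \<in> f ` carrier G" "y \<in> f ` carrier G" for x y
      using that op_plus[OF f] by (metis (no_types, lifting) image_iff M.a_closed)
  qed (rule smult)
  show "submodule (f ` carrier G) K G" by (rule sub)
  show "\<lbrace>x, y\<rbrace>\<^bsub>G\<^esub> \<in> p" if "p \<in> S" "x \<in> f ` carrier G" "y \<in> f ` carrier G" for p x y
    using that comm by blast
  fix F p assume F: "finite F" "F \<subseteq> S" "p \<in> F"
  then have p: "p \<in> S" by blast
  obtain x where x: "x \<in> carrier G" "f x \<notin> p" using nz[OF p] by blast
  \<comment> \<open>The remainder theorem is applied to the argument of f: since f preserves each
    ideal, f y separates p from the rest of F and stays in the image of f.\<close>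
  obtain y where y: "y \<in> carrier G" "coset p y = coset p x" "\<forall>q\<in>F - {p}. y \<in> q"
    using chinese_remainder[of "F - {p}" p x] F S p x by blast
  have "f y \<notin> p"
    using mem_coset_cong[OF lie_idealD(1)[OF ideal[OF p]], of "f y" "f x"]
      op_coset_cong[OF ideal[OF p] f y(1) x(1) y(2)] f x y by simp
  moreover have "\<forall>q\<in>F - {p}. f y \<in> q" using op_ideal[OF ideal f] y(3) F by blast
  ultimately show "\<exists>x\<in>carrier G. (\<forall>q\<in>S. \<exists>y\<in>f ` carrier G. coset q x = coset q y) \<and>
      x \<notin> p \<and> (\<forall>q\<in>F - {p}. x \<in> q)"
    using y(1) f by (intro bexI[of _ "f y"]) auto
qed

text \<open>Bracketing with a suitable element removes the finitely many other ideals from the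
  support, so each p gets an element outside it that lies in all others of S. The lines spanned by
  these elements are abelian and can serve as the A p.\<close>

lemma no_infinite_finite_support:
  assumes wn: "weakly_noetherian K G" and inf: "infinite S"
    and S: "\<And>p. p \<in> S \<Longrightarrow> simple_quotient K G p"
    and supp: "\<And>p. p \<in> S \<Longrightarrow> \<exists>u\<in>carrier G. u \<notin> p \<and> finite {q \<in> S. u \<notin> q}"
  shows False
proof -
  have ideal: "lie_ideal K G p" if "p \<in> S" for p
    using simple_quotient.ideal[OF S[OF that]] .
  have "\<exists>u\<in>carrier G. u \<notin> p \<and> (\<forall>q\<in>S - {p}. u \<in> q)" if p: "p \<in> S" for p
  proof -
    obtain u where u: "u \<in> carrier G" "u \<notin> p" "finite {q \<in> S. u \<notin> q}" using supp[OF p] by blast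
    obtain v where v: "v \<in> carrier G" "\<lbrace>v, u\<rbrace>\<^bsub>G\<^esub> \<notin> p"
      using simple_quotient.bracket_notin[OF S[OF p] u(1,2)] by blast
    \<comment> \<open>Modulo q different from p, either u or y vanishes, so [y, u] does; modulo p it
      is [v, u], which does not.\<close>
    obtain y where y: "y \<in> carrier G" "coset p y = coset p v" "\<forall>q\<in>{q \<in> S. u \<notin> q} - {p}. y \<in> q"
      using chinese_remainder[of "{q \<in> S. u \<notin> q} - {p}" p v] S p u(3) v(1) by blast
    have "\<lbrace>y, u\<rbrace>\<^bsub>G\<^esub> \<notin> p"
      using bracket_coset_cong[OF ideal[OF p] y(1) v(1) y(2) u(1) u(1) refl] v(2) by blast
    moreover have "\<lbrace>y, u\<rbrace>\<^bsub>G\<^esub> \<in> q" if q: "q \<in> S - {p}" for q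
    proof (cases "u \<in> q")
      case True
      then show ?thesis using lie_idealD(2)[OF ideal y(1)] q by blast
    next
      case False
      then have "y \<in> q" using y(3) q by blast
      then show ?thesis using lie_idealD(3)[OF ideal u(1)] q by blast
    qed
    ultimately show ?thesis using y(1) u(1) by (intro bexI[of _ "\<lbrace>y, u\<rbrace>\<^bsub>G\<^esub>"]) auto
  qed
  then obtain U where U: "\<And>p. p \<in> S \<Longrightarrow> U p \<in> carrier G" "\<And>p. p \<in> S \<Longrightarrow> U p \<notin> p"
    "\<And>p q. p \<in> S \<Longrightarrow> q \<in> S - {p} \<Longrightarrow> U p \<in> q"
    by metis
  define A where "A p = (\<lambda>a. a \<odot>\<^bsub>G\<^esub> U p) ` carrier K" for p
  show False
  proof (rule weakly_noetherian_contradiction[OF wn inf ideal, where A = A])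
    fix p assume p: "p \<in> S"
    have AI: "a \<odot>\<^bsub>G\<^esub> U p \<in> A p" if "a \<in> carrier K" for a
      using that by (simp add: A_def)
    have smult: "a \<odot>\<^bsub>G\<^esub> x \<in> A p" if a: "a \<in> carrier K" and x: "x \<in> A p" for a x
    proof -
      obtain b where b: "b \<in> carrier K" "x = b \<odot>\<^bsub>G\<^esub> U p" using x by (auto simp: A_def)
      show ?thesis
        using AI[OF R.m_closed[OF a b(1)]] smult_assoc1[OF a b(1) U(1)[OF p]] b(2) by simp
    qed
    show "submodule (A p) K G"
    proof (rule submoduleI)
      show AG: "A p \<subseteq> carrier G" using U(1)[OF p] by (auto simp: A_def)
      have "\<zero> \<odot>\<^bsub>G\<^esub> U p \<in> A p" by (rule AI[OF R.zero_closed])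
      then show "\<zero>\<^bsub>G\<^esub> \<in> A p" using U(1)[OF p] by simp
      show "\<ominus>\<^bsub>G\<^esub> x \<in> A p" if "x \<in> A p" for x
        using smult[of "\<ominus> \<one>" x] that AG by (auto simp: smult_l_minus subset_iff)
      show "x \<oplus>\<^bsub>G\<^esub> y \<in> A p" if x: "x \<in> A p" and y: "y \<in> A p" for x y
      proof -
        obtain a b where a: "a \<in> carrier K" "x = a \<odot>\<^bsub>G\<^esub> U p"
          and b: "b \<in> carrier K" "y = b \<odot>\<^bsub>G\<^esub> U p"
          using x y by (auto simp: A_def)
        show ?thesis
          using AI[OF R.a_closed[OF a(1) b(1)]] smult_l_distr[OF a(1) b(1) U(1)[OF p]] a(2) b(2)
          by simp
      qed
    qed (rule smult)
    show "\<lbrace>x, y\<rbrace>\<^bsub>G\<^esub> \<in> p" if xy: "x \<in> A p" "y \<in> A p" for x y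
    proof -
      obtain a b where ab: "a \<in> carrier K" "x = a \<odot>\<^bsub>G\<^esub> U p" "b \<in> carrier K" "y = b \<odot>\<^bsub>G\<^esub> U p"
        using xy by (auto simp: A_def)
      have "\<lbrace>x, y\<rbrace>\<^bsub>G\<^esub> = a \<odot>\<^bsub>G\<^esub> \<lbrace>U p, y\<rbrace>\<^bsub>G\<^esub>"
        unfolding ab(2) by (rule bracket_smult_left) (use ab U(1)[OF p] in auto)
      also have "\<lbrace>U p, y\<rbrace>\<^bsub>G\<^esub> = b \<odot>\<^bsub>G\<^esub> \<lbrace>U p, U p\<rbrace>\<^bsub>G\<^esub>"
        unfolding ab(4) by (rule bracket_smult_right[OF ab(3) U(1)[OF p] U(1)[OF p]])
      finally show ?thesis
        using submodule_zero[OF lie_idealD(1)[OF ideal[OF p]]] U(1)[OF p] ab by simp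
    qed
  next
    fix F p assume F: "finite F" "F \<subseteq> S" "p \<in> F"
    then have p: "p \<in> S" by blast
    \<comment> \<open>Modulo p the element \<open>U p\<close> is itself on the line
      \<open>A p\<close>; modulo any other q it is congruent to zero.\<close>
    have "\<exists>y\<in>A q. coset q (U p) = coset q y" if q: "q \<in> S" for q
    proof (cases "q = p")
      case True
      have "\<one> \<odot>\<^bsub>G\<^esub> U p \<in> A p" unfolding A_def by blast
      then show ?thesis using U(1)[OF p] True by auto
    next
      case False
      note qs = lie_idealD(1)[OF ideal[OF q]]
      have "U p \<in> q" using U(3)[OF p] q False by blast
      then have "coset q (U p) = coset q \<zero>\<^bsub>G\<^esub>"
        using coset_eq_self_iff[OF qs U(1)[OF p]] coset_eq_self_iff[OF qs M.zero_closed]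
          submodule_zero[OF qs] by simp
      moreover have "\<zero> \<odot>\<^bsub>G\<^esub> U q \<in> A q" unfolding A_def by blast
      ultimately show ?thesis using U(1)[OF q] by auto
    qed
    moreover have "\<forall>q\<in>F - {p}. U p \<in> q" using U(3)[OF p] F by blast
    ultimately show "\<exists>x\<in>carrier G. (\<forall>q\<in>S. \<exists>y\<in>A q. coset q x = coset q y) \<and>
        x \<notin> p \<and> (\<forall>q\<in>F - {p}. x \<in> q)"
      using U(1,2)[OF p] by blast
  qed
qed

text \<open>Induction on the rank bound, for all S and f together since both change. Ideals modulo
  which f has abelian image are finitely many. For any other p a contraction of f survives modulo p,
  and the induction hypothesis limits the ideals modulo which it survives; one of its values thus
  has finite support.\<close>

lemma no_infinite_bounded_corank:
  assumes wn: "weakly_noetherian K G"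
    and "infinite S" "\<And>p. p \<in> S \<Longrightarrow> simple_quotient K G p" "f \<in> mult_ops K G"
    and "\<And>p. p \<in> S \<Longrightarrow> \<exists>x\<in>carrier G. f x \<notin> p"
    and "\<And>p. p \<in> S \<Longrightarrow> simple_quotient.corank_le K G p n f"
  shows False
  using assms(2-)
proof (induction n arbitrary: S f)
  case (0 S f)
  then obtain p where p: "p \<in> S" by fastforce
  show False using simple_quotient.corank_le_0[OF 0(2)[OF p] 0(5)[OF p] 0(3)] 0(4)[OF p] by blast
next
  case (Suc n S f)
  note S = Suc.prems(2) and f = Suc.prems(3)
  define T where "T = {p \<in> S. \<forall>x\<in>carrier G. \<forall>y\<in>carrier G. \<lbrace>f x, f y\<rbrace>\<^bsub>G\<^esub> \<in> p}"
  have "finite T"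
  proof (rule ccontr)
    assume "infinite T"
    then show False
      by (rule no_infinite_abelian_op[OF wn _ _ f]) (use S Suc.prems(4) in \<open>auto simp: T_def\<close>)
  qed
  then have inf: "infinite (S - T)" using Suc.prems(1) by simp
  have S': "simple_quotient K G p" if "p \<in> S - T" for p using S that by blast
  show False
  proof (rule no_infinite_finite_support[OF wn inf S'])
    fix p assume pST: "p \<in> S - T"
    then obtain x v where xv: "x \<in> carrier G" "v \<in> carrier G" "\<lbrace>f x, f v\<rbrace>\<^bsub>G\<^esub> \<notin> p"
      by (auto simp: T_def)
    obtain B where B: "B \<in> mult_ops K G" "drop_op f v B x \<notin> p"
      using simple_quotient.drop_op_nonzero[OF S'[OF pST] f xv] by blast
    let ?h = "drop_op f v B"
    have h: "?h \<in> mult_ops K G" by (rule drop_op_mult_ops[OF f B(1) xv(2)])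
    \<comment> \<open>Ideals that absorb all values of \<open>?h\<close> are discarded, because the
      induction hypothesis requires an operator that is nonzero modulo each ideal of the
      set.\<close>
    define S'' where "S'' = {q \<in> S - T. \<exists>z\<in>carrier G. ?h z \<notin> q}"
    have "finite S''"
    proof (rule ccontr)
      assume "infinite S''"
      then show False
      proof (rule Suc.IH[OF _ _ h])
        fix q assume q: "q \<in> S''"
        then show qs: "simple_quotient K G q" using S' by (simp add: S''_def)
        show "\<exists>z\<in>carrier G. ?h z \<notin> q" using q by (simp add: S''_def)
        have "simple_quotient.corank_le K G q (Suc n) f" using q Suc.prems(5) by (simp add: S''_def)
        then show "simple_quotient.corank_le K G q n ?h"
          by (rule simple_quotient.corank_le_drop_op[OF qs f _ B(1) xv(2)])
      qed
    qed
    \<comment> \<open>The single value \<open>?h x\<close> survives at most modulo ideals where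
      \<open>?h\<close> does, and it lies outside p by the choice of B.\<close>
    then have "finite {q \<in> S - T. ?h x \<notin> q}"
      by (rule rev_finite_subset) (use xv(1) in \<open>auto simp: S''_def\<close>)
    then show "\<exists>u\<in>carrier G. u \<notin> p \<and> finite {q \<in> S - T. u \<notin> q}"
      using B(2) h xv(1) by (intro bexI[of _ "?h x"]) auto
  qed
qed

end

theorem theorem25:
  fixes K :: "('a, 'm) ring_scheme"
    and G :: "('a, 'b, 'n) lie_algebra_scheme"
    and d :: nat
  assumes "field K"
    and "char_zero K"
    and "lie_algebra K G"
    and "weakly_noetherian K G"
    and "d > 1"
  shows "finite {\<mm>. maximal_lie_ideal K G \<mm> \<and>
                   simple_lie_algebra K (G LieQuot \<mm>) \<and>
                   has_dim (centroid K (G LieQuot \<mm>)) (over_centroid (G LieQuot \<mm>)) d}"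
    (is "finite ?S")
proof (rule ccontr)
  interpret lie_algebra K G by fact
  assume inf: "infinite ?S"
  have S: "simple_quotient K G p" if "p \<in> ?S" for p
    using that by (intro simple_quotient.intro simple_quotient_axioms.intro lie_algebra_axioms) auto
  show False
  proof (rule no_infinite_bounded_corank[OF assms(4) inf S op_id])
    fix p assume p: "p \<in> ?S"
    show "\<exists>x\<in>carrier G. x \<notin> p" using simple_quotient.proper[OF S[OF p]] by blast
    show "simple_quotient.corank_le K G p d (\<lambda>x. x)"
      using simple_quotient.corank_le_id[OF S[OF p]] p by blast
  qed
qed

end
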